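(* Let $c>0$ be a constant and let $t,d\ge 2$ be fixed integers. For $n\in\mathbb{N}$ (sufficiently large) let $N=\binom{n-1}{t-1}$ and let $p=p(n)\in(0,1)$ satisfy $$\frac{(t-1)^d N^d p^d}{n}=\log\left(\frac{n^2}{c}\right).$$ Let $\mathcal{H}$ be a random hypergraph with distribution $\mathscr{H}(n,t,p)$. Then $$\lim_{n\to\infty}\mathbb{P}\left(\mathrm{diam}(\mathcal{H})=d\right)=e^{-c/2}\quad\text{and}\quad \lim_{n\to\infty}\mathbb{P}\left(\mathrm{diam}(\mathcal{H})=d+1\right)=1-e^{-c/2}.$$
   Context: $\mathscr{H}(n,t,p)$ is the random $t$-uniform hypergraph on vertex set $[n]=\{1,\dots,n\}$ in which each $t$-element subset of $[n]$ is included as a hyperedge independently with probability $p$. A path of length $k$ from $x$ to $y$ in a hypergraph is a sequence $(x=x_0,e_1,x_1,\dots,e_k,x_k=y)$ with distinct vertices $x_i$, distinct hyperedges $e_i$, and $x_{i-1},x_i\in e_i$ for each $i$. The distance $d_{\mathcal{H}}(x,y)$ is the minimum length of a path from $x$ to $y$ ($d_{\mathcal{H}}(x,x)=0$, and $d_{\mathcal{H}}(x,y)=\infty$ if there is no path). The diameter is $\mathrm{diam}(\mathcal{H})=\max\{d_{\mathcal{H}}(x,y):x,y\in V(\mathcal{H})\}$ (equal to $\infty$ if $\mathcal{H}$ is disconnected). *)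

theory Defs
  imports "HOL-Probability.Probability" "HOL-Probability.Product_PMF" "HOL-Library.Extended_Nat"
begin

type_synonym 'a hypergraph = "'a set \<times> 'a set set"

abbreviation hverts :: "'a hypergraph \<Rightarrow> 'a set" where "hverts \<equiv> fst"

abbreviation hedges :: "'a hypergraph \<Rightarrow> 'a set set" where "hedges \<equiv> snd"

(* vs lists the vertices x_0, ..., x_k and es the hyperedges e_1, ..., e_k, so that e_(i+1) is es ! i. *)
definition is_hpath :: "'a hypergraph \<Rightarrow> 'a \<Rightarrow> 'a list \<Rightarrow> 'a set list \<Rightarrow> 'a \<Rightarrow> bool" where
  "is_hpath H x vs es y \<longleftrightarrow>
     length vs = length es + 1 \<and>
     set vs \<subseteq> hverts H \<and> set es \<subseteq> hedges H \<and>
     distinct vs \<and> distinct es \<and>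
     vs ! 0 = x \<and> vs ! length es = y \<and>
     (\<forall>i < length es. vs ! i \<in> es ! i \<and> vs ! (i + 1) \<in> es ! i)"

(* The infimum over the empty set is infinity, covering pairs joined by no path. *)
definition hdist :: "'a hypergraph \<Rightarrow> 'a \<Rightarrow> 'a \<Rightarrow> enat" where
  "hdist H x y = Inf {enat (length es) | vs es. is_hpath H x vs es y}"

(* For a finite nonempty vertex set the supremum is a maximum; it is infinity
   as soon as some pair of vertices is at infinite distance. *)
definition hdiam :: "'a hypergraph \<Rightarrow> enat" where
  "hdiam H = (SUP x\<in>hverts H. SUP y\<in>hverts H. hdist H x y)"

definition t_subsets :: "nat \<Rightarrow> nat \<Rightarrow> nat set set" where
  "t_subsets n t = {e. e \<subseteq> {1..n} \<and> card e = t}"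

(* Independent Bernoulli(p) indicators, one for each t-subset of {1..n};
   bernoulli_pmf p has its usual meaning only for 0 \<le> p \<le> 1. *)
definition random_hypergraph :: "nat \<Rightarrow> nat \<Rightarrow> real \<Rightarrow> nat hypergraph pmf" where
  "random_hypergraph n t p =
     map_pmf (\<lambda>b. ({1..n}, {e \<in> t_subsets n t. b e}))
       (Pi_pmf (t_subsets n t) False (\<lambda>_. bernoulli_pmf p))"

end

theory Submission
  imports Defs
begin

text \<open>
  Let L = ln (n^2 / c) and let l = (t - 1) N p, where N = (n - 1) choose (t - 1), be the
  expected number of moves from a fixed vertex along a hyperedge, so that l^d = n L. A path of
  length d between two fixed vertices x and y is present on average l^d / n = L times, and
  shorter paths are negligible. If the paths behaved independently, x and y would be at distance
  more than d (far) with probability exp (- L) = c / n^2. Then the expected number of far pairs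
  is about c / 2, and if that number is asymptotically Poisson there is no far pair with
  probability exp (- c / 2).

  The proof makes this heuristic exact without exploring neighbourhoods. For every set F of r
  pairs, the event that all pairs in F are far says that none of certain sets of hyperedges,
  those of the short paths, is present. For such events there are two-sided bounds. The Harris
  inequality gives at least the product of the individual probabilities of absence
  (prob_far_ge), and the Janson inequality gives at most exp (- \<mu> + \<Delta>), where \<mu>
  is the expected number of paths and \<Delta> the expected number of overlapping pairs of them
  (prob_far_le). For the upper bound it is enough to look at loose paths, which are determined
  by their set of hyperedges. A path that shares a hyperedge with a given one and is different
  from it has one free move fewer, so \<Delta> is of order L^2 / l and tends to 0; this is
  sum_mixed_walks. Since both bounds are sharp up to a factor tending to 1 uniformly in F,
  whether or not the pairs in F share vertices, every binomial moment of the number of far pairs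
  converges to that of the Poisson distribution with mean c / 2 (binomial_moment_limit), and the
  Bonferroni inequalities yield that the diameter is at most d with probability tending to exp
  (- c / 2) (prob_small_diam_limit).

  It remains to see that the diameter is asymptotically almost surely at least d and at most d +
  1. The first follows from the same Harris bound for one pair and distance d - 1. For the
  second, the result for d + 1 in place of d is applied with a smaller edge probability p' and
  an arbitrarily small constant c', and the event is monotone in the edge probability.
\<close>

section \<open>Correlation inequalities for independent coins\<close>

definition coins :: "'a set \<Rightarrow> real \<Rightarrow> ('a \<Rightarrow> bool) pmf" where
  "coins A p = Pi_pmf A False (\<lambda>_. bernoulli_pmf p)"

abbreviation pr :: "'a set \<Rightarrow> real \<Rightarrow> (('a \<Rightarrow> bool) \<Rightarrow> bool) \<Rightarrow> real" where
  "pr A p Q \<equiv> measure_pmf.prob (coins A p) {b. Q b}"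

lemma pr_mono: "(\<And>b. Q b \<Longrightarrow> Q' b) \<Longrightarrow> pr A p Q \<le> pr A p Q'"
  by (rule measure_pmf.finite_measure_mono) auto

lemma pr_not: "pr A p (\<lambda>b. \<not> Q b) = 1 - pr A p Q"
proof -
  have "pr A p (\<lambda>b. \<not> Q b) = measure_pmf.prob (coins A p) (space (measure_pmf (coins A p)) - {b. Q b})"
    by (rule arg_cong[where f = "measure_pmf.prob _"]) auto
  then show ?thesis
    by (simp only: measure_pmf.prob_compl sets_measure_pmf UNIV_I)
qed

lemma pr_split: "pr A p Q = pr A p (\<lambda>b. R b \<and> Q b) + pr A p (\<lambda>b. \<not> R b \<and> Q b)"
proof -
  have "pr A p Q = measure_pmf.prob (coins A p) ({b. R b \<and> Q b} \<union> {b. \<not> R b \<and> Q b})"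
    by (rule arg_cong[where f = "measure_pmf.prob _"]) auto
  also have "\<dots> = pr A p (\<lambda>b. R b \<and> Q b) + pr A p (\<lambda>b. \<not> R b \<and> Q b)"
    by (rule measure_pmf.finite_measure_Union) auto
  finally show ?thesis .
qed

text \<open>Conditioning on a single coin. Every statement about all events on finitely many
  coins below is proved by induction with this recursion.\<close>
lemma pr_insert:
  assumes "finite A" "x \<notin> A" "0 \<le> p" "p \<le> 1"
  shows "pr (insert x A) p Q =
     p * pr A p (\<lambda>b. Q (b(x := True))) + (1 - p) * pr A p (\<lambda>b. Q (b(x := False)))"
proof -
  have "emeasure (coins (insert x A) p) {b. Q b} =
      ennreal p * emeasure (coins A p) {b. Q (b(x := True))} +
      ennreal (1 - p) * emeasure (coins A p) {b. Q (b(x := False))}"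
    unfolding coins_def Pi_pmf_insert'[OF assms(1,2)] map_pmf_def[symmetric] emeasure_bind_pmf
    using assms by (simp add: vimage_def mult.commute)
  then have "ennreal (pr (insert x A) p Q) =
     ennreal (p * pr A p (\<lambda>b. Q (b(x := True))) + (1 - p) * pr A p (\<lambda>b. Q (b(x := False))))"
    using assms by (simp add: measure_pmf.emeasure_eq_measure ennreal_mult' ennreal_plus)
  then show ?thesis
    using assms by (subst (asm) ennreal_inj) auto
qed

definition increasing :: "(('a \<Rightarrow> bool) \<Rightarrow> bool) \<Rightarrow> bool" where
  "increasing Q \<longleftrightarrow> (\<forall>b b'. (\<forall>x. b x \<longrightarrow> b' x) \<longrightarrow> Q b \<longrightarrow> Q b')"

definition decreasing :: "(('a \<Rightarrow> bool) \<Rightarrow> bool) \<Rightarrow> bool" where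
  "decreasing Q \<longleftrightarrow> (\<forall>b b'. (\<forall>x. b x \<longrightarrow> b' x) \<longrightarrow> Q b' \<longrightarrow> Q b)"

lemma increasing_upd:
  assumes "increasing Q"
  shows "increasing (\<lambda>b. Q (b(x := v)))" "Q (b(x := False)) \<Longrightarrow> Q (b(x := True))"
proof -
  show "increasing (\<lambda>b. Q (b(x := v)))"
    unfolding increasing_def
  proof (intro allI impI)
    fix b b' assume "\<forall>y. b y \<longrightarrow> b' y" "Q (b(x := v))"
    moreover from this have "\<forall>y. (b(x := v)) y \<longrightarrow> (b'(x := v)) y" by simp
    ultimately show "Q (b'(x := v))" using assms unfolding increasing_def by blast
  qed
  have "\<forall>y. (b(x := False)) y \<longrightarrow> (b(x := True)) y" by simp
  then show "Q (b(x := False)) \<Longrightarrow> Q (b(x := True))"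
    using assms unfolding increasing_def by blast
qed

lemma decreasing_iff: "decreasing Q \<longleftrightarrow> increasing (\<lambda>b. \<not> Q b)"
  unfolding increasing_def decreasing_def by blast

lemma decreasing_upd:
  assumes "decreasing Q"
  shows "decreasing (\<lambda>b. Q (b(x := v)))" "Q (b(x := True)) \<Longrightarrow> Q (b(x := False))"
  using increasing_upd(1)[OF assms[unfolded decreasing_iff], of x v]
    increasing_upd(2)[OF assms[unfolded decreasing_iff], of b x] unfolding decreasing_iff by auto

lemma increasing_all: "increasing (\<lambda>b. \<forall>x\<in>S. b x)"
  by (auto simp: increasing_def)

lemma decreasing_none: "decreasing (\<lambda>b. \<forall>i\<in>I. \<not> (\<forall>x\<in>S i. b x))"
  unfolding decreasing_def by blast

text \<open>Raising the bias can only help an increasing event. This replaces a coupling of the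
  two random hypergraphs.\<close>
lemma pr_mono_in_bias:
  assumes "finite A" "0 \<le> p" "p \<le> p'" "p' \<le> 1" "increasing Q"
  shows "pr A p Q \<le> pr A p' Q"
  using assms(1,5)
proof (induction A arbitrary: Q rule: finite_induct)
  case empty
  then show ?case by (simp add: coins_def)
next
  case (insert x A)
  let ?T = "\<lambda>b. Q (b(x := True))" and ?F = "\<lambda>b. Q (b(x := False))"
  have m: "increasing ?T" "increasing ?F"
    using insert.prems by (rule increasing_upd)+
  have "pr A p ?F \<le> pr A p ?T"
    by (rule pr_mono) (rule increasing_upd(2)[OF insert.prems(1)])
  then have "(p' - p) * pr A p ?F \<le> (p' - p) * pr A p ?T"
    using assms by (intro mult_left_mono) auto
  then have "p * pr A p ?T + (1 - p) * pr A p ?F \<le> p' * pr A p ?T + (1 - p') * pr A p ?F"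
    by (simp add: algebra_simps)
  also have "\<dots> \<le> p' * pr A p' ?T + (1 - p') * pr A p' ?F"
    using assms by (intro add_mono mult_left_mono insert.IH m) simp_all
  finally show ?case
    using assms insert by (simp add: pr_insert)
qed

text \<open>Induction over the coins: after conditioning on one coin, the induction hypothesis
  handles both halves, and what remains is Chebyshev's sum inequality for two values, one pair
  of conditional probabilities increasing and the other one decreasing in the coin.\<close>
theorem Harris_inequality:
  assumes "finite A" "0 \<le> p" "p \<le> 1" "increasing Q" "decreasing Q'"
  shows "pr A p (\<lambda>b. Q b \<and> Q' b) \<le> pr A p Q * pr A p Q'"
  using assms(1,4,5)
proof (induction A arbitrary: Q Q' rule: finite_induct)
  case empty
  then show ?case by (simp add: coins_def indicator_def)
next
  case (insert x A)
  let ?T = "\<lambda>Q b. Q (b(x := True))" and ?F = "\<lambda>Q b. Q (b(x := False))"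
  have m: "increasing (?T Q)" "increasing (?F Q)" "decreasing (?T Q')" "decreasing (?F Q')"
    using insert.prems by (simp_all add: increasing_upd decreasing_upd)
  have 1: "pr A p (?F Q) \<le> pr A p (?T Q)"
    by (rule pr_mono) (rule increasing_upd(2)[OF insert.prems(1)])
  have 2: "pr A p (?T Q') \<le> pr A p (?F Q')"
    by (rule pr_mono) (rule decreasing_upd(2)[OF insert.prems(2)])
  have "0 \<le> p * (1 - p) * ((pr A p (?T Q) - pr A p (?F Q)) * (pr A p (?F Q') - pr A p (?T Q')))"
    using 1 2 assms by (intro mult_nonneg_nonneg) auto
  then have "p * (pr A p (?T Q) * pr A p (?T Q')) + (1 - p) * (pr A p (?F Q) * pr A p (?F Q'))
     \<le> (p * pr A p (?T Q) + (1 - p) * pr A p (?F Q)) * (p * pr A p (?T Q') + (1 - p) * pr A p (?F Q'))"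
    by (simp add: algebra_simps)
  moreover have "p * pr A p (\<lambda>b. ?T Q b \<and> ?T Q' b) + (1 - p) * pr A p (\<lambda>b. ?F Q b \<and> ?F Q' b)
     \<le> p * (pr A p (?T Q) * pr A p (?T Q')) + (1 - p) * (pr A p (?F Q) * pr A p (?F Q'))"
    using assms by (intro add_mono mult_left_mono insert.IH m) simp_all
  ultimately show ?case
    using assms insert by (simp add: pr_insert)
qed

corollary Harris_inequality_decreasing:
  assumes "finite A" "0 \<le> p" "p \<le> 1" "decreasing Q" "decreasing Q'"
  shows "pr A p Q * pr A p Q' \<le> pr A p (\<lambda>b. Q b \<and> Q' b)"
proof -
  have "increasing (\<lambda>b. \<not> Q b)"
    using assms(4) unfolding increasing_def decreasing_def by blast
  from Harris_inequality[OF assms(1-3) this assms(5)]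
  have "pr A p (\<lambda>b. \<not> Q b \<and> Q' b) \<le> (1 - pr A p Q) * pr A p Q'"
    by (simp add: pr_not)
  then show ?thesis
    using pr_split[of A p Q' Q] by (simp add: algebra_simps)
qed

text \<open>Independence is expressed by invariance of the event under updates of the
  coin.\<close>
lemma pr_coin_independent:
  assumes "finite A" "0 \<le> p" "p \<le> 1" "x \<in> A" "\<And>b v. Q (b(x := v)) = Q b"
  shows "pr A p (\<lambda>b. b x \<and> Q b) = p * pr A p Q"
proof -
  have A: "A = insert x (A - {x})" using assms by auto
  show ?thesis
    using assms by (subst (1 2) A, subst (1 2) pr_insert) (auto simp: algebra_simps)
qed

lemma pr_all_independent:
  assumes "finite A" "0 \<le> p" "p \<le> 1" "S \<subseteq> A"
    and "\<And>b x v. x \<in> S \<Longrightarrow> Q (b(x := v)) = Q b"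
  shows "pr A p (\<lambda>b. (\<forall>x\<in>S. b x) \<and> Q b) = p ^ card S * pr A p Q"
proof -
  have "finite S" using assms(1,4) finite_subset by blast
  then show ?thesis
    using assms(4,5)
  proof (induction S rule: finite_induct)
    case (insert x S)
    have "pr A p (\<lambda>b. b x \<and> (\<forall>x\<in>S. b x) \<and> Q b) = p * pr A p (\<lambda>b. (\<forall>x\<in>S. b x) \<and> Q b)"
    proof (rule pr_coin_independent)
      fix b v
      have "(\<forall>y\<in>S. (b(x := v)) y) = (\<forall>y\<in>S. b y)"
        using insert.hyps(2) by auto
      then show "((\<forall>y\<in>S. (b(x := v)) y) \<and> Q (b(x := v))) = ((\<forall>y\<in>S. b y) \<and> Q b)"
        using insert.prems(2)[of x b v] by (simp only: insertI1)
    qed (use insert assms(1-3) in auto)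
    then show ?case
      using insert by (simp add: conj_assoc)
  qed simp
qed

corollary pr_all:
  assumes "finite A" "0 \<le> p" "p \<le> 1" "S \<subseteq> A"
  shows "pr A p (\<lambda>b. \<forall>x\<in>S. b x) = p ^ card S"
  using pr_all_independent[OF assms, of "\<lambda>_. True"] by simp

text \<open>The complement of each event is decreasing, so these complements are positively
  correlated. The sets may overlap arbitrarily; this is why the lower bound in the theorem needs
  no second-moment estimate.\<close>
lemma Harris_no_set_occurs:
  assumes "finite A" "0 \<le> p" "p \<le> 1" "finite I" "\<And>i. i \<in> I \<Longrightarrow> S i \<subseteq> A"
  shows "(\<Prod>i\<in>I. 1 - p ^ card (S i)) \<le> pr A p (\<lambda>b. \<forall>i\<in>I. \<not> (\<forall>x\<in>S i. b x))"
  using assms(4,5)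
proof (induction I rule: finite_induct)
  case (insert i I)
  have "(\<Prod>i\<in>insert i I. 1 - p ^ card (S i)) = (1 - p ^ card (S i)) * (\<Prod>i\<in>I. 1 - p ^ card (S i))"
    using insert by simp
  also have "\<dots> \<le> (1 - p ^ card (S i)) * pr A p (\<lambda>b. \<forall>i\<in>I. \<not> (\<forall>x\<in>S i. b x))"
    using insert assms by (intro mult_left_mono) (auto intro: power_le_one)
  also have "\<dots> = pr A p (\<lambda>b. \<not> (\<forall>x\<in>S i. b x)) * pr A p (\<lambda>b. \<forall>i\<in>I. \<not> (\<forall>x\<in>S i. b x))"
    using insert assms(1-3) by (subst pr_not) (simp add: pr_all)
  also have "\<dots> \<le> pr A p (\<lambda>b. \<not> (\<forall>x\<in>S i. b x) \<and> (\<forall>i\<in>I. \<not> (\<forall>x\<in>S i. b x)))"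
    by (intro Harris_inequality_decreasing[OF assms(1-3)] decreasing_none)
       (auto simp: decreasing_def)
  finally show ?case by simp
qed simp

text \<open>The events of disjoint sets are independent of the occurrence of S_k. Write C for
  the event that no set disjoint from S_k occurs. Then P(S_k \<and> C) = P(S_k) P(C), while for
  a set meeting S_k the Harris inequality gives P(S_k \<and> S_j \<and> C) \<le> P(S_k \<and>
  S_j) P(C). Subtracting the latter shows that, given that no set of I occurs, S_k still occurs
  with probability at least P(S_k) minus the sum of the P(S_k \<and> S_j).\<close>
lemma Janson_step:
  assumes "finite A" "0 \<le> p" "p \<le> 1" "finite I" "\<And>i. i \<in> insert k I \<Longrightarrow> S i \<subseteq> A"
  defines "none \<equiv> \<lambda>I b. \<forall>i\<in>I. \<not> (\<forall>x\<in>S i. b x)"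
  shows "pr A p (none (insert k I)) \<le> pr A p (none I) *
     exp (- (p ^ card (S k)) + (\<Sum>j | j \<in> I \<and> S k \<inter> S j \<noteq> {}. p ^ card (S k \<union> S j)))"
proof -
  define J where "J = {j \<in> I. S k \<inter> S j \<noteq> {}}"
  define s where "s = (\<Sum>j\<in>J. p ^ card (S k \<union> S j))"
  define C where "C = none (I - J)"
  have fJ: "finite J" using assms(4) by (simp add: J_def)
  have C_le: "pr A p (none I) \<le> pr A p C"
    by (rule pr_mono) (auto simp: C_def none_def)
  have anti: "decreasing C"
    unfolding C_def none_def by (rule decreasing_none)
  have indep: "pr A p (\<lambda>b. (\<forall>x\<in>S k. b x) \<and> C b) = p ^ card (S k) * pr A p C"
  proof (rule pr_all_independent[OF assms(1-3)])
    show "S k \<subseteq> A" using assms(5) by simp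
    fix b x v assume x: "x \<in> S k"
    have "x \<notin> S i" if "i \<in> I - J" for i
      using x that by (auto simp: J_def)
    then have "(\<exists>y\<in>S i. \<not> (b(x := v)) y) = (\<exists>y\<in>S i. \<not> b y)" if "i \<in> I - J" for i
      using that by (metis fun_upd_apply)
    then show "C (b(x := v)) = C b"
      unfolding C_def none_def by simp
  qed
  have "pr A p (\<lambda>b. (\<forall>x\<in>S k. b x) \<and> \<not> none J b \<and> C b)
      \<le> measure_pmf.prob (coins A p) (\<Union>j\<in>J. {b. (\<forall>x\<in>S k \<union> S j. b x) \<and> C b})"
    by (rule measure_pmf.finite_measure_mono) (auto simp: none_def)
  also have "\<dots> \<le> (\<Sum>j\<in>J. pr A p (\<lambda>b. (\<forall>x\<in>S k \<union> S j. b x) \<and> C b))"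
    using fJ by (intro measure_pmf.finite_measure_subadditive_finite) auto
  also have "\<dots> \<le> (\<Sum>j\<in>J. p ^ card (S k \<union> S j) * pr A p C)"
  proof (rule sum_mono)
    fix j assume "j \<in> J"
    then have sub: "S k \<union> S j \<subseteq> A" using assms(5) by (auto simp: J_def)
    have "increasing (\<lambda>b. \<forall>x\<in>S k \<union> S j. b x)"
      by (rule increasing_all)
    from Harris_inequality[OF assms(1-3) this anti]
    show "pr A p (\<lambda>b. (\<forall>x\<in>S k \<union> S j. b x) \<and> C b) \<le> p ^ card (S k \<union> S j) * pr A p C"
      by (simp only: pr_all[OF assms(1-3) sub])
  qed
  finally have meet: "pr A p (\<lambda>b. (\<forall>x\<in>S k. b x) \<and> \<not> none J b \<and> C b) \<le> s * pr A p C"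
    by (simp add: s_def sum_distrib_right)
  have none_I: "none I = (\<lambda>b. none J b \<and> C b)"
    by (auto simp: C_def none_def J_def fun_eq_iff)
  have "pr A p (\<lambda>b. (\<forall>x\<in>S k. b x) \<and> C b) =
      pr A p (\<lambda>b. none J b \<and> (\<forall>x\<in>S k. b x) \<and> C b) + pr A p (\<lambda>b. \<not> none J b \<and> (\<forall>x\<in>S k. b x) \<and> C b)"
    by (rule pr_split)
  also have "(\<lambda>b. \<not> none J b \<and> (\<forall>x\<in>S k. b x) \<and> C b) = (\<lambda>b. (\<forall>x\<in>S k. b x) \<and> \<not> none J b \<and> C b)"
    by auto
  also have "(\<lambda>b. none J b \<and> (\<forall>x\<in>S k. b x) \<and> C b) = (\<lambda>b. (\<forall>x\<in>S k. b x) \<and> none I b)"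
    by (auto simp: none_I)
  finally have lower: "(p ^ card (S k) - s) * pr A p C \<le> pr A p (\<lambda>b. (\<forall>x\<in>S k. b x) \<and> none I b)"
    using meet indep by (simp add: algebra_simps)
  have lower': "(p ^ card (S k) - s) * pr A p (none I) \<le> pr A p (\<lambda>b. (\<forall>x\<in>S k. b x) \<and> none I b)"
  proof (cases "p ^ card (S k) - s \<ge> 0")
    case True
    from mult_left_mono[OF C_le this] lower show ?thesis by linarith
  next
    case False
    then have "(p ^ card (S k) - s) * pr A p (none I) \<le> 0"
      by (intro mult_nonpos_nonneg) auto
    then show ?thesis
      using measure_nonneg order_trans by blast
  qed
  have "none (insert k I) = (\<lambda>b. \<not> (\<forall>x\<in>S k. b x) \<and> none I b)"
    by (auto simp: none_def fun_eq_iff)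
  then have "pr A p (none (insert k I)) = pr A p (none I) - pr A p (\<lambda>b. (\<forall>x\<in>S k. b x) \<and> none I b)"
    using pr_split[of A p "none I" "\<lambda>b. \<forall>x\<in>S k. b x"] by simp
  also have "\<dots> \<le> pr A p (none I) * (1 + (- (p ^ card (S k)) + s))"
    using lower' by (simp add: algebra_simps)
  also have "\<dots> \<le> pr A p (none I) * exp (- (p ^ card (S k)) + s)"
    by (intro mult_left_mono exp_ge_add_one_self) auto
  finally show ?thesis
    by (simp add: s_def J_def)
qed

text \<open>The overlap sum runs over ordered pairs, twice the customary correction term; in the
  application it tends to 0 either way.\<close>
theorem Janson_inequality:
  assumes "finite A" "0 \<le> p" "p \<le> 1" "finite I" "\<And>i. i \<in> I \<Longrightarrow> S i \<subseteq> A"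
  shows "pr A p (\<lambda>b. \<forall>i\<in>I. \<not> (\<forall>x\<in>S i. b x)) \<le>
     exp (- (\<Sum>i\<in>I. p ^ card (S i)) +
          (\<Sum>i\<in>I. \<Sum>j | j \<in> I \<and> j \<noteq> i \<and> S i \<inter> S j \<noteq> {}. p ^ card (S i \<union> S j)))"
  using assms(4,5)
proof (induction I rule: finite_induct)
  case (insert k I)
  let ?none = "\<lambda>I b. \<forall>i\<in>I. \<not> (\<forall>x\<in>S i. b x)"
  let ?D = "\<lambda>I. (\<Sum>i\<in>I. \<Sum>j | j \<in> I \<and> j \<noteq> i \<and> S i \<inter> S j \<noteq> {}. p ^ card (S i \<union> S j))"
  let ?s = "\<Sum>j | j \<in> I \<and> S k \<inter> S j \<noteq> {}. p ^ card (S k \<union> S j)"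
  have "pr A p (?none (insert k I)) \<le> pr A p (?none I) * exp (- (p ^ card (S k)) + ?s)"
    using Janson_step[OF assms(1-3) insert.hyps(1) insert.prems] by simp
  also have "\<dots> \<le> exp (- (\<Sum>i\<in>I. p ^ card (S i)) + ?D I) * exp (- (p ^ card (S k)) + ?s)"
    using insert.IH insert.prems by (intro mult_right_mono) auto
  also have "\<dots> = exp (- (\<Sum>i\<in>insert k I. p ^ card (S i)) + (?s + ?D I))"
    using insert.hyps by (simp add: exp_add[symmetric])
  also have "?s + ?D I \<le> ?D (insert k I)"
  proof -
    have "?s \<le> (\<Sum>j | j \<in> insert k I \<and> j \<noteq> k \<and> S k \<inter> S j \<noteq> {}. p ^ card (S k \<union> S j))"
      using insert.hyps assms(2) by (intro sum_mono2) auto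
    moreover have "?D I \<le> (\<Sum>i\<in>I. \<Sum>j | j \<in> insert k I \<and> j \<noteq> i \<and> S i \<inter> S j \<noteq> {}. p ^ card (S i \<union> S j))"
      using insert.hyps assms(2) by (intro sum_mono sum_mono2) auto
    ultimately show ?thesis
      using insert.hyps by simp
  qed
  finally show ?case by simp
qed simp

section \<open>Inclusion-exclusion bounds\<close>

lemma alternating_choose_sum:
  assumes "m > 0"
  shows "(\<Sum>j\<le>r. (-1) ^ j * real (m choose j)) = (-1) ^ r * real ((m - 1) choose r)"
  using gbinomial_sum_lower_neg[of "real m" r] assms
  by (simp add: binomial_gbinomial of_nat_diff mult.commute)

text \<open>With X the number of the events B f that hold, the sum over F of size j of the
  probabilities that all events in F hold is the expectation of X choose j, and the alternating
  partial sums of the X choose j overshoot or undershoot the indicator of X = 0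
  pointwise.\<close>
lemma Bonferroni_inequalities:
  fixes M :: "'a pmf" and B :: "'v \<Rightarrow> 'a \<Rightarrow> bool"
  assumes fin: "finite V"
  defines "s \<equiv> \<lambda>r. \<Sum>j\<le>r. (-1) ^ j * (\<Sum>F | F \<subseteq> V \<and> card F = j. measure_pmf.prob M {b. \<forall>f\<in>F. B f b})"
  shows "even r \<Longrightarrow> measure_pmf.prob M {b. \<forall>f\<in>V. \<not> B f b} \<le> s r"
    and "odd r \<Longrightarrow> s r \<le> measure_pmf.prob M {b. \<forall>f\<in>V. \<not> B f b}"
proof -
  define X where "X = (\<lambda>b. card {f \<in> V. B f b})"
  have fin_sub: "finite {F. F \<subseteq> V \<and> card F = j}" for j
    using fin by simp
  have choose: "real (X b choose j) = (\<Sum>F | F \<subseteq> V \<and> card F = j. indicator {b. \<forall>f\<in>F. B f b} b)" for b j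
  proof -
    have "(\<Sum>F | F \<subseteq> V \<and> card F = j. indicator {b. \<forall>f\<in>F. B f b} b) =
        (\<Sum>F\<in>{F. F \<subseteq> V \<and> card F = j} \<inter> {F. \<forall>f\<in>F. B f b}. (1::real))"
      using fin_sub by (simp add: indicator_def sum.If_cases)
    also have "{F. F \<subseteq> V \<and> card F = j} \<inter> {F. \<forall>f\<in>F. B f b} = {F. F \<subseteq> {f \<in> V. B f b} \<and> card F = j}"
      by auto
    also have "(\<Sum>F\<in>\<dots>. (1::real)) = real (X b choose j)"
      using fin n_subsets[of "{f \<in> V. B f b}" j] by (simp add: X_def)
    finally show ?thesis by simp
  qed
  have int1: "integrable M (\<lambda>b. (-1) ^ j * real (X b choose j))" for j
    unfolding choose by (intro integrable_mult_right Bochner_Integration.integrable_sum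
        measure_pmf.integrable_const_bound[where B = 1]) (auto simp: indicator_def)
  have "(\<integral>b. (\<Sum>j\<le>r. (-1) ^ j * real (X b choose j)) \<partial>M) =
      (\<Sum>j\<le>r. \<integral>b. (-1) ^ j * real (X b choose j) \<partial>M)" for r
    using int1 by (intro Bochner_Integration.integral_sum) auto
  also have "(\<Sum>j\<le>r. \<integral>b. (-1) ^ j * real (X b choose j) \<partial>M) = s r" for r
    unfolding s_def choose
    by (subst integral_mult_right_zero, subst Bochner_Integration.integral_sum)
       (auto intro!: measure_pmf.integrable_const_bound[where B = 1] simp: indicator_le_1)
  finally have s_int: "s r = (\<integral>b. (\<Sum>j\<le>r. (-1) ^ j * real (X b choose j)) \<partial>M)" for r ..
  have int2: "integrable M (\<lambda>b. \<Sum>j\<le>r. (-1) ^ j * real (X b choose j))" for r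
    using int1 by auto
  have ind: "measure_pmf.prob M {b. \<forall>f\<in>V. \<not> B f b} = (\<integral>b. indicator {b. \<forall>f\<in>V. \<not> B f b} b \<partial>M)"
    by simp
  have int3: "integrable M (\<lambda>b. indicator {b. \<forall>f\<in>V. \<not> B f b} b :: real)"
    by (rule measure_pmf.integrable_const_bound[where B = 1]) (auto simp: indicator_def)
  have X0: "(\<forall>f\<in>V. \<not> B f b) \<longleftrightarrow> X b = 0" for b
    using fin by (auto simp: X_def)
  have sum0: "(\<Sum>j\<le>r. (-1) ^ j * real (0 choose j)) = 1" for r
    by (induction r) auto
  show "measure_pmf.prob M {b. \<forall>f\<in>V. \<not> B f b} \<le> s r" if "even r"
    unfolding ind s_int
  proof (rule integral_mono[OF int3 int2])
    fix b
    show "indicator {b. \<forall>f\<in>V. \<not> B f b} b \<le> (\<Sum>j\<le>r. (-1) ^ j * real (X b choose j))"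
      using that by (cases "X b = 0") (simp_all add: X0 sum0 alternating_choose_sum)
  qed
  show "s r \<le> measure_pmf.prob M {b. \<forall>f\<in>V. \<not> B f b}" if "odd r"
    unfolding ind s_int
  proof (rule integral_mono[OF int2 int3])
    fix b
    show "(\<Sum>j\<le>r. (-1) ^ j * real (X b choose j)) \<le> indicator {b. \<forall>f\<in>V. \<not> B f b} b"
      using that by (cases "X b = 0") (simp_all add: X0 sum0 alternating_choose_sum)
  qed
qed

section \<open>Walks in hypergraphs\<close>

text \<open>A walk is stored as the list of its moves, a move being a hyperedge together with
  the vertex in which it is left; the start is a separate argument. Vertices and hyperedges may
  repeat, so that walks can be counted by a one-step recursion.\<close>
definition steps :: "'a set set \<Rightarrow> 'a \<Rightarrow> ('a set \<times> 'a) set" where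
  "steps E u = {(e, z). e \<in> E \<and> u \<in> e \<and> z \<in> e \<and> z \<noteq> u}"

primrec walks :: "'a set set \<Rightarrow> nat \<Rightarrow> 'a \<Rightarrow> 'a \<Rightarrow> ('a set \<times> 'a) list set" where
  "walks E 0 u y = (if u = y then {[]} else {})"
| "walks E (Suc k) u y = (\<Union>a\<in>steps E u. Cons a ` walks E k (snd a) y)"

abbreviation edges_of :: "('a set \<times> 'a) list \<Rightarrow> 'a set set" where
  "edges_of ws \<equiv> fst ` set ws"

lemma walks_length: "ws \<in> walks E k u y \<Longrightarrow> length ws = k"
  by (induction k arbitrary: u ws) (auto split: if_splits)

lemma walks_edges: "ws \<in> walks E k u y \<Longrightarrow> edges_of ws \<subseteq> E"
  by (induction k arbitrary: u ws) (fastforce split: if_splits simp: steps_def)+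

lemma walks_start: "ws \<in> walks E k u y \<Longrightarrow> edges_of ws \<subseteq> S \<Longrightarrow> k > 0 \<Longrightarrow> u \<in> \<Union>S"
  by (cases k) (auto simp: steps_def)

lemma sum_Cons_image:
  assumes "finite T" "\<And>a. a \<in> T \<Longrightarrow> finite (W a)"
  shows "sum f (\<Union>a\<in>T. Cons a ` W a) = (\<Sum>a\<in>T. \<Sum>ws\<in>W a. f (a # ws))"
proof -
  have "sum f (\<Union>a\<in>T. Cons a ` W a) = (\<Sum>a\<in>T. sum f (Cons a ` W a))"
    using assms by (intro sum.UNION_disjoint) auto
  also have "\<dots> = (\<Sum>a\<in>T. \<Sum>ws\<in>W a. f (a # ws))"
  proof (rule sum.cong[OF refl])
    fix a assume "a \<in> T"
    have "inj_on (Cons a) (W a)" by simp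
    from sum.reindex[OF this, of f] show "sum f (Cons a ` W a) = (\<Sum>ws\<in>W a. f (a # ws))"
      by (simp add: o_def)
  qed
  finally show ?thesis .
qed

lemma is_hpath_walk:
  assumes "length vs = length es + 1" "distinct vs" "set es \<subseteq> E" "vs ! 0 = x"
    and "\<forall>i<length es. vs ! i \<in> es ! i \<and> vs ! (i + 1) \<in> es ! i"
  shows "zip es (tl vs) \<in> walks E (length es) x (vs ! length es)"
  using assms
proof (induction es arbitrary: vs x)
  case Nil
  then show ?case by (cases vs) auto
next
  case (Cons e es)
  from Cons.prems obtain z vs' where vs: "vs = x # z # vs'"
    by (cases vs; cases "tl vs") auto
  have "zip es (tl (z # vs')) \<in> walks E (length es) z ((z # vs') ! length es)"
  proof (rule Cons.IH)
    show "\<forall>i<length es. (z # vs') ! i \<in> es ! i \<and> (z # vs') ! (i + 1) \<in> es ! i"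
    proof (intro allI impI)
      fix i assume "i < length es"
      then have "Suc i < length (e # es)" by simp
      then show "(z # vs') ! i \<in> es ! i \<and> (z # vs') ! (i + 1) \<in> es ! i"
        using Cons.prems(5)[rule_format, of "Suc i"] by (simp add: vs)
    qed
  qed (use Cons.prems vs in auto)
  moreover have "(e, z) \<in> steps E x"
    using Cons.prems(2,3) Cons.prems(5)[rule_format, of 0] by (auto simp: steps_def vs)
  ultimately show ?case
    by (auto simp: vs intro!: bexI[of _ "(e, z)"])
qed

lemma walk_is_hpath:
  assumes "ws \<in> walks E k x y" "E \<subseteq> Pow V" "x \<in> V"
    and "distinct (map fst ws)" "distinct (x # map snd ws)" "edges_of ws \<subseteq> R"
  shows "is_hpath (V, R) x (x # map snd ws) (map fst ws) y"
proof -
  have "set (map snd ws) \<subseteq> V \<and> (x # map snd ws) ! k = y \<and>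
     (\<forall>i<k. (x # map snd ws) ! i \<in> map fst ws ! i \<and> map snd ws ! i \<in> map fst ws ! i)"
    using assms(1)
  proof (induction k arbitrary: x ws)
    case (Suc k)
    then obtain e z ws' where ws: "ws = (e, z) # ws'" "(e, z) \<in> steps E x" "ws' \<in> walks E k z y"
      by auto
    show ?case
      using Suc.IH[OF ws(3)] ws(1,2) assms(2)
      by (auto simp: steps_def nth_Cons split: nat.split)
  qed (auto split: if_splits)
  then show ?thesis
    using assms walks_length[OF assms(1)] by (auto simp: is_hpath_def)
qed

text \<open>Only pairs with x < y are tested for being far, which is enough because distance is
  symmetric.\<close>
lemma is_hpath_rev:
  assumes "is_hpath H x vs es y"
  shows "is_hpath H y (rev vs) (rev es) x"
proof -
  have len: "length vs = length es + 1" using assms by (simp add: is_hpath_def)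
  have "rev vs ! i \<in> rev es ! i \<and> rev vs ! (i + 1) \<in> rev es ! i" if i: "i < length es" for i
  proof -
    define j where "j = length es - Suc i"
    have j: "j < length es" "length es - i = Suc j" using i by (auto simp: j_def)
    have "vs ! j \<in> es ! j \<and> vs ! (j + 1) \<in> es ! j"
      using assms j by (simp add: is_hpath_def)
    then show ?thesis
      using i j len by (simp add: rev_nth j_def[symmetric])
  qed
  then show ?thesis
    using assms len by (auto simp: is_hpath_def rev_nth)
qed

lemma hdist_sym: "hdist H x y = hdist H y x"
proof -
  have "hdist H x y \<le> hdist H y x" for x y :: 'a
    unfolding hdist_def
    by (intro Inf_superset_mono subsetI) (auto, metis is_hpath_rev length_rev)
  then show ?thesis by (simp add: order_antisym)
qed

lemma hdist_le_iff: "hdist H x y \<le> enat k \<longleftrightarrow> (\<exists>vs es. is_hpath H x vs es y \<and> length es \<le> k)"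
proof
  assume "hdist H x y \<le> enat k"
  then have "Inf {enat (length es) | vs es. is_hpath H x vs es y} < enat (Suc k)"
    unfolding hdist_def using enat_ord_simps(2) order_le_less_trans by blast
  then show "\<exists>vs es. is_hpath H x vs es y \<and> length es \<le> k"
    by (subst (asm) Inf_less_iff) (auto simp: less_Suc_eq_le; blast)
next
  assume "\<exists>vs es. is_hpath H x vs es y \<and> length es \<le> k"
  then obtain vs es where *: "is_hpath H x vs es y" "length es \<le> k" by blast
  have "hdist H x y \<le> enat (length es)"
    unfolding hdist_def by (rule Inf_lower) (use * in auto)
  also have "\<dots> \<le> enat k" using * by simp
  finally show "hdist H x y \<le> enat k" .
qed

lemma short_distance_walk:
  assumes "hdist (V, R) x y \<le> enat d" "x \<noteq> y" "R \<subseteq> E"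
  obtains k ws where "k < d" "ws \<in> walks E (Suc k) x y" "distinct (map fst ws)" "edges_of ws \<subseteq> R"
proof -
  obtain vs es where p: "is_hpath (V, R) x vs es y" "length es \<le> d"
    using assms(1) by (auto simp: hdist_le_iff)
  have len: "length vs = length es + 1" using p by (simp add: is_hpath_def)
  have "zip es (tl vs) \<in> walks E (length es) x (vs ! length es)"
    by (rule is_hpath_walk) (use p assms(3) in \<open>auto simp: is_hpath_def\<close>)
  moreover have "es \<noteq> []" using p assms(2) by (auto simp: is_hpath_def)
  then obtain k where "length es = Suc k" by (cases es) auto
  moreover have "map fst (zip es (tl vs)) = es" using len by simp
  moreover from this have "edges_of (zip es (tl vs)) = set es" by (metis set_map)
  ultimately show ?thesis
    using p by (intro that[of k "zip es (tl vs)"]) (auto simp: is_hpath_def)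
qed

section \<open>Counting walks\<close>

text \<open>If the hyperedges of S are already known to be present, a walk with distinct
  hyperedges is present with probability weight S p ws.\<close>
definition weight :: "'a set set \<Rightarrow> real \<Rightarrow> ('a set \<times> 'a) list \<Rightarrow> real" where
  "weight S p ws = p ^ length (filter (\<lambda>a. fst a \<notin> S) ws)"

text \<open>The mixed walks are the ones that can cause correlation between a path with
  hyperedge set S and another one of the same length: they share a hyperedge with S but are not
  contained in S.\<close>
definition mixed :: "'a set set \<Rightarrow> ('a set \<times> 'a) list \<Rightarrow> bool" where
  "mixed S ws \<longleftrightarrow> (\<exists>a\<in>set ws. fst a \<in> S) \<and> (\<exists>a\<in>set ws. fst a \<notin> S)"

text \<open>The degree counts pairs of a hyperedge and a second vertex on it.\<close>
locale bounded_degree_hypergraph =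
  fixes E :: "'a set set" and t \<Delta> M :: nat
  assumes finite_E: "finite E"
    and uniform: "e \<in> E \<Longrightarrow> card e = t"
    and t_ge_2: "t \<ge> 2"
    and degree: "card (steps E u) \<le> \<Delta>"
    and codegree: "u \<noteq> v \<Longrightarrow> card {e \<in> E. u \<in> e \<and> v \<in> e} \<le> M"
begin

lemma finite_edge: "e \<in> E \<Longrightarrow> finite e"
  using uniform t_ge_2 by (metis card.infinite not_numeral_le_zero)

lemma finite_steps: "finite (steps E u)"
proof (rule finite_subset)
  show "steps E u \<subseteq> E \<times> \<Union>E" by (auto simp: steps_def)
  show "finite (E \<times> \<Union>E)" using finite_E finite_edge by blast
qed

lemma finite_walks: "finite (walks E k u y)"
  by (induction k arbitrary: u) (auto simp: finite_steps)

lemma sum_walks_Suc: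
  "sum f (walks E (Suc k) u y) = (\<Sum>a\<in>steps E u. \<Sum>ws\<in>walks E k (snd a) y. f (a # ws))"
  by (simp add: sum_Cons_image finite_steps finite_walks)

text \<open>Each move but the last has at most \<Delta> choices; the last one must hit
  y.\<close>
lemma card_walks: "card (walks E (Suc k) u y) \<le> \<Delta> ^ k * M"
proof (induction k arbitrary: u)
  case 0
  have "walks E 1 u y \<subseteq> (\<lambda>e. [(e, y)]) ` {e \<in> E. u \<in> e \<and> y \<in> e \<and> u \<noteq> y}"
    by (auto simp: steps_def split: if_splits)
  then have "card (walks E 1 u y) \<le> card {e \<in> E. u \<in> e \<and> y \<in> e \<and> u \<noteq> y}"
    by (rule surj_card_le[rotated]) (use finite_E in auto)
  also have "\<dots> \<le> M" using codegree[of u y] by (cases "u = y") auto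
  finally show ?case by simp
next
  case (Suc k)
  have "card (walks E (Suc (Suc k)) u y) = (\<Sum>a\<in>steps E u. card (walks E (Suc k) (snd a) y))"
    using sum_walks_Suc[of "\<lambda>_. 1::nat" "Suc k" u y] by (simp del: walks.simps)
  also have "\<dots> \<le> (\<Sum>a\<in>steps E u. \<Delta> ^ k * M)"
    by (intro sum_mono Suc.IH)
  also have "\<dots> \<le> \<Delta> * (\<Delta> ^ k * M)"
    using degree by simp
  finally show ?case by simp
qed

context
  fixes S :: "'a set set" and D :: nat
  assumes S: "S \<subseteq> E" and D: "card S * t \<le> D"
begin

lemma finite_S: "finite S" "finite (\<Union>S)"
  using S finite_E finite_subset finite_edge by (blast, meson S finite_E finite_Union finite_subset finite_edge subsetD)

lemma card_Union_S: "card (\<Union>S) \<le> D"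
proof -
  have "card (\<Union>S) \<le> sum card S" by (rule card_Union_le_sum_card)
  also have "\<dots> = card S * t" using S uniform by (simp add: subset_iff)
  finally show ?thesis using D by simp
qed

lemma card_steps_in_S: "card {a \<in> steps E u. fst a \<in> S} \<le> D"
proof -
  have "card {a \<in> steps E u. fst a \<in> S} \<le> card (SIGMA e:S. e)"
    using finite_S finite_edge S by (intro card_mono) (auto simp: steps_def)
  also have "\<dots> = (\<Sum>e\<in>S. card e)" using finite_S finite_edge S by (subst card_SigmaI) auto
  also have "\<dots> = card S * t" using S uniform by (simp add: subset_iff)
  finally show ?thesis using D by simp
qed

lemma card_steps_to_S: "card {a \<in> steps E u. snd a \<in> \<Union>S} \<le> D * M"
proof -
  have "card {a \<in> steps E u. snd a \<in> \<Union>S} \<le> card (SIGMA z:\<Union>S - {u}. {e \<in> E. u \<in> e \<and> z \<in> e})"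
    by (rule card_inj_on_le[where f = "\<lambda>(e, z). (z, e)"])
       (use finite_S finite_E in \<open>auto simp: steps_def inj_on_def\<close>)
  also have "\<dots> = (\<Sum>z\<in>\<Union>S - {u}. card {e \<in> E. u \<in> e \<and> z \<in> e})"
    using finite_S finite_E by (subst card_SigmaI) auto
  also have "\<dots> \<le> (\<Sum>z\<in>\<Union>S - {u}. M)"
    by (intro sum_mono codegree) auto
  also have "\<dots> = card (\<Union>S - {u}) * M" by simp
  also have "\<dots> \<le> D * M"
    using card_Union_S card_mono[of "\<Union>S" "\<Union>S - {u}"] finite_S by (intro mult_right_mono) auto
  finally show ?thesis .
qed

lemma sum_walks_inside_S:
  "(\<Sum>ws\<in>walks E k u y. of_bool (edges_of ws \<subseteq> S)) \<le> real D ^ k"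
proof (induction k arbitrary: u)
  case (Suc k)
  have "(\<Sum>ws\<in>walks E (Suc k) u y. of_bool (edges_of ws \<subseteq> S)) =
      (\<Sum>a\<in>steps E u. of_bool (fst a \<in> S) * (\<Sum>ws\<in>walks E k (snd a) y. of_bool (edges_of ws \<subseteq> S)) :: real)"
    by (subst sum_walks_Suc) (auto intro!: sum.cong simp: sum_distrib_left)
  also have "\<dots> \<le> (\<Sum>a\<in>steps E u. of_bool (fst a \<in> S) * real D ^ k)"
    by (intro sum_mono mult_left_mono Suc.IH) auto
  also have "\<dots> = real (card {a \<in> steps E u. fst a \<in> S}) * real D ^ k"
    using finite_steps by (simp add: sum_distrib_right[symmetric] Int_def)
  also have "\<dots> \<le> real D * real D ^ k"
    using card_steps_in_S by (intro mult_right_mono) auto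
  finally show ?case by simp
qed auto

text \<open>Splitting off the first move. If the rest is mixed, the move costs a factor of at
  most D + l. If the rest lies inside S, there are boundedly many such rests and the first move
  must hit one of the boundedly many vertices of S, which costs q. If the rest avoids S, the
  first move is one of at most D moves inside S and the rest has total weight at most l ^ (k -
  1) * q. The gain over the weight l ^ k * q of all walks of this length is a factor l: a shared
  hyperedge removes one free move.\<close>
lemma sum_mixed_walks:
  fixes p l q :: real
  assumes p: "0 \<le> p" and l: "p * real \<Delta> \<le> l" "1 \<le> l" and q: "p * real M \<le> q"
  shows "(\<Sum>ws | ws \<in> walks E (Suc k) u y \<and> mixed S ws. weight S p ws)
     \<le> real k * (1 + real D) ^ Suc k * l ^ (k - 1) * q"
proof -
  define g :: "('a set \<times> 'a) list \<Rightarrow> real" where "g ws = of_bool (mixed S ws) * weight S p ws" for ws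
  let ?D = "real D"
  have q0: "0 \<le> q" using p q by (metis mult_nonneg_nonneg of_nat_0_le_iff order_trans)
  have g_Cons: "g (a # ws) \<le> (of_bool (fst a \<in> S) + p) * g ws
      + p * of_bool (edges_of ws \<subseteq> S) + of_bool (fst a \<in> S) * p ^ length ws" for a ws
  proof -
    have w0: "weight S p ws \<ge> 0" using p by (simp add: weight_def)
    consider "\<not> mixed S (a # ws)" | "mixed S ws" | "\<not> mixed S ws" "fst a \<in> S" "\<forall>a\<in>set ws. fst a \<notin> S"
      | "\<not> mixed S ws" "fst a \<notin> S" "edges_of ws \<subseteq> S"
      by (auto simp: mixed_def)
    then show ?thesis
    proof cases
      case 1
      then show ?thesis using p w0 by (simp add: g_def)
    next
      case 2
      then have "g (a # ws) = (if fst a \<in> S then 1 else p) * weight S p ws" "g ws = weight S p ws"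
        by (auto simp: g_def weight_def mixed_def)
      moreover have "(if fst a \<in> S then 1 else p) * weight S p ws \<le> (of_bool (fst a \<in> S) + p) * weight S p ws"
        using p w0 by (intro mult_right_mono) auto
      moreover have "0 \<le> p * of_bool (edges_of ws \<subseteq> S)" "0 \<le> of_bool (fst a \<in> S) * p ^ length ws"
        using p by auto
      ultimately show ?thesis by (simp only:)
    next
      case 3
      then have "filter (\<lambda>a. fst a \<notin> S) ws = ws" by simp
      then show ?thesis using p 3 by (auto simp: g_def weight_def)
    next
      case 4
      then have "filter (\<lambda>a. fst a \<notin> S) ws = []" by (auto simp: filter_empty_conv)
      then show ?thesis using p 4 by (auto simp: g_def weight_def)
    qed
  qed
  have "(\<Sum>ws\<in>walks E (Suc k) u y. g ws) \<le> real k * (1 + ?D) ^ Suc k * l ^ (k - 1) * q"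
  proof (induction k arbitrary: u)
    case 0
    have "g ws = 0" if "ws \<in> walks E (Suc 0) u y" for ws
      using that by (auto simp: g_def mixed_def split: if_splits)
    then have "(\<Sum>ws\<in>walks E (Suc 0) u y. g ws) = 0" by (rule sum.neutral[rule_format])
    then show ?case by simp
  next
    case (Suc k)
    let ?B = "real k * (1 + ?D) ^ Suc k * l ^ (k - 1) * q"
    have B0: "?B \<ge> 0" using l q0 by simp
    let ?W = "\<lambda>a. walks E (Suc k) (snd a) y"
    have inner: "(\<Sum>ws\<in>?W a. g (a # ws)) \<le> (of_bool (fst a \<in> S) + p) * ?B
       + p * (of_bool (snd a \<in> \<Union>S) * ?D ^ Suc k) + of_bool (fst a \<in> S) * (l ^ k * q)" for a
    proof -
      have "(\<Sum>ws\<in>?W a. g (a # ws)) \<le> (\<Sum>ws\<in>?W a. (of_bool (fst a \<in> S) + p) * g ws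
        + p * of_bool (edges_of ws \<subseteq> S) + of_bool (fst a \<in> S) * p ^ Suc k)"
        by (intro sum_mono order_trans[OF g_Cons]) (simp add: walks_length del: walks.simps)
      also have "\<dots> = (of_bool (fst a \<in> S) + p) * (\<Sum>ws\<in>?W a. g ws)
        + p * (\<Sum>ws\<in>?W a. of_bool (edges_of ws \<subseteq> S)) + of_bool (fst a \<in> S) * (real (card (?W a)) * p ^ Suc k)"
        by (simp add: sum.distrib sum_distrib_left del: walks.simps)
      also have "\<dots> \<le> (of_bool (fst a \<in> S) + p) * ?B
         + p * (of_bool (snd a \<in> \<Union>S) * ?D ^ Suc k) + of_bool (fst a \<in> S) * (l ^ k * q)"
      proof (intro add_mono mult_left_mono)
        show "(\<Sum>ws\<in>?W a. g ws) \<le> ?B" by (rule Suc.IH)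
        show "(\<Sum>ws\<in>?W a. of_bool (edges_of ws \<subseteq> S)) \<le> of_bool (snd a \<in> \<Union>S) * ?D ^ Suc k"
        proof (cases "snd a \<in> \<Union>S")
          case True
          then show ?thesis using sum_walks_inside_S[of "Suc k" "snd a" y] by simp
        next
          case False
          then have "\<not> edges_of ws \<subseteq> S" if "ws \<in> ?W a" for ws
            using walks_start[OF that, of S] by blast
          then show ?thesis by (simp del: walks.simps)
        qed
        have "real (card (?W a)) * p ^ Suc k \<le> real (\<Delta> ^ k * M) * p ^ Suc k"
          using card_walks p by (intro mult_right_mono) (auto simp del: walks.simps of_nat_mult of_nat_power)
        also have "\<dots> = (p * \<Delta>) ^ k * (p * M)" by (simp add: power_mult_distrib algebra_simps)
        also have "\<dots> \<le> l ^ k * q"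
          using l p q q0 by (intro mult_mono power_mono) auto
        finally show "real (card (?W a)) * p ^ Suc k \<le> l ^ k * q" .
      qed (use p in auto)
      finally show ?thesis .
    qed
    have "(\<Sum>ws\<in>walks E (Suc (Suc k)) u y. g ws) \<le> (\<Sum>a\<in>steps E u. (of_bool (fst a \<in> S) + p) * ?B
       + p * (of_bool (snd a \<in> \<Union>S) * ?D ^ Suc k) + of_bool (fst a \<in> S) * (l ^ k * q))"
      by (subst sum_walks_Suc) (intro sum_mono inner)
    also have "\<dots> = (real (card {a \<in> steps E u. fst a \<in> S}) + p * real (card (steps E u))) * ?B
       + p * (real (card {a \<in> steps E u. snd a \<in> \<Union>S}) * ?D ^ Suc k)
       + real (card {a \<in> steps E u. fst a \<in> S}) * (l ^ k * q)"
      using finite_steps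
      by (simp only: sum.distrib sum_distrib_left[symmetric] sum_distrib_right[symmetric])
         (simp add: Int_def sum.distrib algebra_simps)
    also have "\<dots> \<le> (?D + l) * ?B + p * (real (D * M) * ?D ^ Suc k) + ?D * (l ^ k * q)"
    proof (intro add_mono mult_left_mono mult_right_mono)
      have "p * real (card (steps E u)) \<le> p * real \<Delta>"
        using degree p by (intro mult_left_mono) auto
      then show "p * real (card (steps E u)) \<le> l" using l by linarith
      show "real (card {a \<in> steps E u. snd a \<in> \<Union>S}) \<le> real (D * M)"
        using card_steps_to_S of_nat_mono by blast
    qed (use p B0 l q0 card_steps_in_S in auto)
    also have "\<dots> = (?D + l) * ?B + ?D ^ (k + 2) * (p * M) + ?D * (l ^ k * q)"
      by (simp add: algebra_simps)
    also have "\<dots> \<le> ((1 + ?D) * l) * ?B + ?D ^ (k + 2) * (l ^ k * q) + ?D * (l ^ k * q)"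
    proof (intro add_mono mult_left_mono mult_right_mono B0)
      have "?D * 1 \<le> ?D * l" using l by (intro mult_left_mono) auto
      then show "?D + l \<le> (1 + ?D) * l" by (simp add: algebra_simps)
      have "1 * q \<le> l ^ k * q"
        using l q0 by (intro mult_right_mono one_le_power) auto
      then show "p * M \<le> l ^ k * q" using q by linarith
    qed (use l q0 in auto)
    also have "((1 + ?D) * l) * ?B = real k * (1 + ?D) ^ (k + 2) * (l ^ k * q)"
      by (cases k) (simp_all add: algebra_simps)
    also have "\<dots> + ?D ^ (k + 2) * (l ^ k * q) + ?D * (l ^ k * q) =
        (real k * (1 + ?D) ^ (k + 2) + (?D ^ (k + 2) + ?D)) * (l ^ k * q)"
      by (simp add: algebra_simps)
    also have "\<dots> \<le> (real k * (1 + ?D) ^ (k + 2) + (1 + ?D) ^ (k + 2)) * (l ^ k * q)"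
    proof (intro mult_right_mono add_left_mono)
      have "?D ^ (k + 1) \<le> (1 + ?D) ^ (k + 1)" by (intro power_mono) auto
      then have "?D * ?D ^ (k + 1) \<le> ?D * (1 + ?D) ^ (k + 1)" by (intro mult_left_mono) auto
      moreover have "(1 + ?D) ^ 1 \<le> (1 + ?D) ^ (k + 1)" by (intro power_increasing) auto
      ultimately show "?D ^ (k + 2) + ?D \<le> (1 + ?D) ^ (k + 2)" by (simp add: algebra_simps)
    qed (use l q0 in auto)
    also have "\<dots> = real (Suc k) * (1 + ?D) ^ Suc (Suc k) * l ^ (Suc k - 1) * q"
      by (simp add: algebra_simps)
    finally show ?case .
  qed
  moreover have "(\<Sum>ws | ws \<in> walks E (Suc k) u y \<and> mixed S ws. weight S p ws) = (\<Sum>ws\<in>walks E (Suc k) u y. g ws)"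
    unfolding g_def using finite_walks by (simp add: Int_def del: walks.simps)
  ultimately show ?thesis by simp
qed

end

end

section \<open>Loose paths\<close>

text \<open>A loose path meets the set A of vertices seen so far only where it must: a hyperedge
  shares one vertex with everything before it, and only the last one also contains the target y.
  The index k is the number of hyperedges minus one. For a hyperedge set so constrained both the
  endpoints and the order of traversal can be read off, and still almost all walks are of this
  kind.\<close>
primrec loose_paths :: "'a set set \<Rightarrow> nat \<Rightarrow> 'a set \<Rightarrow> 'a \<Rightarrow> 'a \<Rightarrow> ('a set \<times> 'a) list set" where
  "loose_paths E 0 A u y = (\<lambda>e. [(e, y)]) ` {e \<in> E. e \<inter> A = {u, y}}"
| "loose_paths E (Suc k) A u y =
     (\<Union>a\<in>{a \<in> steps E u. fst a \<inter> A = {u}}. Cons a ` loose_paths E k (A \<union> fst a) (snd a) y)"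

lemma loose_paths_SucE:
  assumes "ws \<in> loose_paths E (Suc k) A u y"
  obtains e z ws' where "ws = (e, z) # ws'" "ws' \<in> loose_paths E k (A \<union> e) z y"
    "e \<in> E" "e \<inter> A = {u}" "z \<in> e" "z \<noteq> u" "z \<notin> A"
proof -
  from assms obtain a ws' where a: "a \<in> steps E u" "fst a \<inter> A = {u}" "ws = a # ws'"
    "ws' \<in> loose_paths E k (A \<union> fst a) (snd a) y"
    by auto
  obtain e z where ez: "a = (e, z)" by fastforce
  have "e \<in> E" "z \<in> e" "z \<noteq> u" using a(1) ez by (auto simp: steps_def)
  moreover from this have "z \<notin> A" using a(2) ez by auto
  ultimately show ?thesis using a ez by (intro that[of e z ws']) auto
qed

lemma loose_paths_walks: "ws \<in> loose_paths E k A u y \<Longrightarrow> u \<in> A \<Longrightarrow> y \<in> A \<Longrightarrow> u \<noteq> y \<Longrightarrow> ws \<in> walks E (Suc k) u y"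
proof (induction k arbitrary: A u ws)
  case 0
  then obtain e where "ws = [(e, y)]" "e \<in> E" "e \<inter> A = {u, y}" by auto
  moreover from this have "u \<in> e" "y \<in> e" by blast+
  ultimately show ?case using 0 by (simp add: steps_def)
next
  case (Suc k)
  from Suc.prems(1) obtain e z ws' where ws: "ws = (e, z) # ws'" "ws' \<in> loose_paths E k (A \<union> e) z y"
    "e \<in> E" "e \<inter> A = {u}" "z \<in> e" "z \<noteq> u" "z \<notin> A" by (rule loose_paths_SucE)
  then have "ws' \<in> walks E (Suc k) z y"
    using Suc.prems by (intro Suc.IH[OF ws(2)]) auto
  moreover have "(e, z) \<in> steps E u"
    using ws(3-6) by (auto simp: steps_def)
  ultimately show ?case
    unfolding ws(1) by (subst walks.simps(2)) (rule UN_I[of "(e, z)"], simp_all del: walks.simps)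
qed

lemma loose_paths_meet: "ws \<in> loose_paths E k A u y \<Longrightarrow> u \<in> A \<Longrightarrow> y \<in> A \<Longrightarrow> u \<noteq> y \<Longrightarrow> \<Union>(edges_of ws) \<inter> A = {u, y}"
proof (induction k arbitrary: A u ws)
  case 0
  then obtain e where "ws = [(e, y)]" "e \<inter> A = {u, y}" by auto
  then show ?case by simp
next
  case (Suc k)
  from Suc.prems(1) obtain e z ws' where ws: "ws = (e, z) # ws'" "ws' \<in> loose_paths E k (A \<union> e) z y"
    "e \<in> E" "e \<inter> A = {u}" "z \<in> e" "z \<noteq> u" "z \<notin> A" by (rule loose_paths_SucE)
  have "\<Union>(edges_of ws') \<inter> (A \<union> e) = {z, y}"
    using ws Suc.prems by (intro Suc.IH[OF ws(2)]) auto
  then have "\<Union>(edges_of ws') \<inter> A = {z, y} \<inter> A" by blast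
  also have "\<dots> = {y}" using ws(7) Suc.prems(3) by simp
  finally have "\<Union>(edges_of ws') \<inter> A = {y}" .
  then show ?case unfolding ws(1) by (simp add: Int_Un_distrib2 ws(4) insert_commute)
qed

text \<open>The first hyperedge is recognisable as the only one containing u, and the exit z as
  its only common vertex with the others.\<close>
lemma loose_paths_Cons:
  assumes "(e, z) # ws \<in> loose_paths E (Suc k) A u y" "u \<in> A" "y \<in> A" "u \<noteq> y"
  shows "ws \<in> loose_paths E k (A \<union> e) z y" "u \<in> e" "z \<in> A \<union> e" "y \<in> A \<union> e" "z \<noteq> y"
    "\<And>e'. e' \<in> edges_of ws \<Longrightarrow> u \<notin> e'" "e \<inter> \<Union>(edges_of ws) = {z}"
proof -
  obtain e0 z0 ws0 where eq: "(e, z) # ws = (e0, z0) # ws0" and *: "ws0 \<in> loose_paths E k (A \<union> e0) z0 y"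
    "e0 \<in> E" "e0 \<inter> A = {u}" "z0 \<in> e0" "z0 \<noteq> u" "z0 \<notin> A"
    by (rule loose_paths_SucE[OF assms(1)])
  have "e0 = e" "z0 = z" "ws0 = ws" using eq by simp_all
  note * = *[unfolded this]
  have ue: "u \<in> e" using *(3) by blast
  have ye: "y \<notin> e"
  proof
    assume "y \<in> e"
    then have "y \<in> e \<inter> A" using assms(3) by simp
    then show False using *(3) assms(4) by simp
  qed
  have zy: "z \<noteq> y" using *(6) assms(3) by blast
  have m: "\<Union>(edges_of ws) \<inter> (A \<union> e) = {z, y}"
    by (rule loose_paths_meet[OF *(1)]) (use * assms(3) zy in simp_all)
  show "ws \<in> loose_paths E k (A \<union> e) z y" "u \<in> e" "z \<in> A \<union> e" "y \<in> A \<union> e" "z \<noteq> y"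
    using *(1,4) ue zy assms(3) by simp_all
  show "u \<notin> e'" if "e' \<in> edges_of ws" for e'
  proof
    assume "u \<in> e'"
    then have "u \<in> \<Union>(edges_of ws) \<inter> (A \<union> e)" using that ue by blast
    then show False using m *(5) assms(4) by simp
  qed
  have "e \<inter> \<Union>(edges_of ws) = {z, y} \<inter> e" using m by blast
  then show "e \<inter> \<Union>(edges_of ws) = {z}"
    using *(4) ye by simp
qed

lemma loose_paths_distinct:
  "ws \<in> loose_paths E k A u y \<Longrightarrow> u \<in> A \<Longrightarrow> y \<in> A \<Longrightarrow> u \<noteq> y \<Longrightarrow>
     distinct (map fst ws) \<and> distinct (u # map snd ws) \<and> (\<forall>a\<in>set ws. snd a \<in> fst a)"
proof (induction k arbitrary: A u ws)
  case 0
  then obtain e where "ws = [(e, y)]" "e \<inter> A = {u, y}" by auto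
  moreover from this have "y \<in> e" by blast
  ultimately show ?case using 0 by simp
next
  case (Suc k)
  from Suc.prems(1) obtain e z ws' where ws: "ws = (e, z) # ws'" and z: "z \<in> e" "z \<noteq> u"
    by (rule loose_paths_SucE)
  note * = loose_paths_Cons[OF Suc.prems(1)[unfolded ws] Suc.prems(2-)]
  have IH: "distinct (map fst ws')" "distinct (z # map snd ws')" "\<forall>a\<in>set ws'. snd a \<in> fst a"
    using Suc.IH[OF *(1,3,4,5)] by auto
  have "e \<notin> set (map fst ws')" using *(2,6) by auto
  moreover have "u \<notin> set (map snd ws')" using *(6) IH(3) by fastforce
  ultimately show ?case using IH ws z by auto
qed

lemma loose_paths_determined_by_edges:
  assumes "ws \<in> loose_paths E k A u y" "ws' \<in> loose_paths E k A u y" "u \<in> A" "y \<in> A" "u \<noteq> y"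
    and "edges_of ws = edges_of ws'"
  shows "ws = ws'"
  using assms
proof (induction k arbitrary: A u ws ws')
  case 0
  then show ?case by auto
next
  case (Suc k)
  from Suc.prems(1) obtain e z v where ws: "ws = (e, z) # v" by (rule loose_paths_SucE)
  from Suc.prems(2) obtain e' z' v' where ws': "ws' = (e', z') # v'" by (rule loose_paths_SucE)
  note p1 = loose_paths_Cons[OF Suc.prems(1)[unfolded ws] Suc.prems(3-5)]
  note p2 = loose_paths_Cons[OF Suc.prems(2)[unfolded ws'] Suc.prems(3-5)]
  have ins: "insert e (edges_of v) = insert e' (edges_of v')"
    using Suc.prems(6) by (simp add: ws ws')
  have "e \<in> insert e' (edges_of v')" by (simp only: ins[symmetric] insertI1)
  then have e: "e = e'" using p1(2) p2(6)[of e] by auto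
  have "e \<notin> edges_of v" "e' \<notin> edges_of v'" using p1(2) p1(6)[of e] p2(2) p2(6)[of e'] by auto
  then have v: "edges_of v = edges_of v'" using ins e by (metis insert_ident)
  have "{z} = {z'}" using p1(7) p2(7) v e by simp
  then have z: "z = z'" by simp
  have "v = v'"
    using Suc.IH[OF p1(1) _ p1(3-5) v] p2(1) e z by simp
  then show ?case using ws ws' e z by simp
qed

section \<open>Counting in the complete uniform hypergraph\<close>

text \<open>Removing the trace B leaves an arbitrary subset of V - A.\<close>
lemma card_with_trace:
  assumes "finite V" "A \<subseteq> V" "B \<subseteq> A" "card B \<le> t"
  shows "card {e. e \<subseteq> V \<and> card e = t \<and> e \<inter> A = B} = (card V - card A) choose (t - card B)"
proof -
  have fA: "finite A" by (rule finite_subset[OF assms(2,1)])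
  have fin: "finite A" "finite B" using fA finite_subset[OF assms(3) fA] by auto
  have "bij_betw (\<lambda>f. f \<union> B) {f. f \<subseteq> V - A \<and> card f = t - card B} {e. e \<subseteq> V \<and> card e = t \<and> e \<inter> A = B}"
  proof (rule bij_betw_byWitness[where f' = "\<lambda>e. e - A"])
    show "(\<lambda>f. f \<union> B) ` {f. f \<subseteq> V - A \<and> card f = t - card B} \<subseteq> {e. e \<subseteq> V \<and> card e = t \<and> e \<inter> A = B}"
    proof safe
      fix f assume f: "f \<subseteq> V - A" "card f = t - card B"
      then have "finite f" by (intro finite_subset[OF _ assms(1)]) auto
      then have "card (f \<union> B) = card f + card B"
        using f fin assms(3) by (intro card_Un_disjoint) auto
      then show "card (f \<union> B) = t" using f assms(4) by simp
    qed (use assms in auto)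
    show "(\<lambda>e. e - A) ` {e. e \<subseteq> V \<and> card e = t \<and> e \<inter> A = B} \<subseteq> {f. f \<subseteq> V - A \<and> card f = t - card B}"
      using fin by (auto simp: card_Diff_subset_Int)
  qed (use assms in auto)
  from bij_betw_same_card[OF this] have "card {e. e \<subseteq> V \<and> card e = t \<and> e \<inter> A = B} = card {f. f \<subseteq> V - A \<and> card f = t - card B}"
    by simp
  also have "\<dots> = card (V - A) choose (t - card B)"
    using assms by (intro n_subsets) auto
  also have "card (V - A) = card V - card A"
    using assms fin by (simp add: card_Diff_subset)
  finally show ?thesis .
qed

lemma t_subsets_trace:
  assumes "A \<subseteq> {1..n}" "B \<subseteq> A" "card B \<le> t"
  shows "card {e \<in> t_subsets n t. e \<inter> A = B} = (n - card A) choose (t - card B)"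
  using card_with_trace[of "{1..n}" A B t] assms by (simp add: t_subsets_def conj_assoc)

lemma finite_t_subsets: "finite (t_subsets n t)"
  by (rule finite_subset[of _ "Pow {1..n}"]) (auto simp: t_subsets_def)

lemma card_steps_trace:
  assumes "u \<in> A" "A \<subseteq> {1..n}" "t \<ge> 2"
  shows "card {a \<in> steps (t_subsets n t) u. fst a \<inter> A = {u}} = (t - 1) * ((n - card A) choose (t - 1))"
proof -
  let ?X = "{e \<in> t_subsets n t. e \<inter> A = {u}}"
  have ue: "u \<in> e" if "e \<inter> A = {u}" for e using that by blast
  then have "{a \<in> steps (t_subsets n t) u. fst a \<inter> A = {u}} = (SIGMA e:?X. e - {u})"
    unfolding set_eq_iff split_paired_all by (simp add: steps_def) metis
  also have "card \<dots> = (\<Sum>e\<in>?X. card (e - {u}))"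
    using finite_t_subsets[of n t] by (subst card_SigmaI) (auto simp: t_subsets_def intro: finite_subset)
  also have "\<dots> = (\<Sum>e\<in>?X. t - 1)"
    using ue by (intro sum.cong refl) (simp add: t_subsets_def card_Diff_singleton)
  also have "\<dots> = (t - 1) * ((n - card A) choose (t - 1))"
    using t_subsets_trace[of A n "{u}" t] assms by simp
  finally show ?thesis .
qed

lemma t_subsets_bounded_degree:
  assumes "t \<ge> 2"
  shows "bounded_degree_hypergraph (t_subsets n t) t ((t - 1) * ((n - 1) choose (t - 1))) ((n - 2) choose (t - 2))"
proof
  show "card (steps (t_subsets n t) u) \<le> (t - 1) * ((n - 1) choose (t - 1))" for u
  proof (cases "u \<in> {1..n}")
    case True
    have "{a \<in> steps (t_subsets n t) u. fst a \<inter> {u} = {u}} = steps (t_subsets n t) u"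
      by (auto simp: steps_def)
    then show ?thesis using card_steps_trace[of u "{u}" n t] True assms by simp
  next
    case False
    then have "steps (t_subsets n t) u = {}" by (auto simp: steps_def t_subsets_def)
    then show ?thesis by simp
  qed
  show "card {e \<in> t_subsets n t. u \<in> e \<and> v \<in> e} \<le> (n - 2) choose (t - 2)" if "u \<noteq> v" for u v
  proof (cases "{u, v} \<subseteq> {1..n}")
    case True
    have "{e \<in> t_subsets n t. e \<inter> {u, v} = {u, v}} = {e \<in> t_subsets n t. u \<in> e \<and> v \<in> e}"
      by auto
    then show ?thesis
      using t_subsets_trace[of "{u, v}" n "{u, v}" t] True that assms by (simp add: numeral_2_eq_2)
  next
    case False
    then have *: "{e \<in> t_subsets n t. u \<in> e \<and> v \<in> e} = {}" by (auto simp: t_subsets_def)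
    show ?thesis unfolding * by simp
  qed
qed (use assms finite_t_subsets in \<open>auto simp: t_subsets_def\<close>)

lemma finite_loose_paths: "finite (loose_paths (t_subsets n t) k A u y)"
proof (induction k arbitrary: A u)
  case (Suc k)
  have "finite (steps (t_subsets n t) u)"
    by (rule finite_subset[of _ "Pow {1..n} \<times> {1..n}"]) (auto simp: steps_def t_subsets_def)
  then show ?case using Suc.IH by simp
qed (simp add: finite_t_subsets)

text \<open>At most K vertices are ever forbidden, so each hyperedge can be completed within at
  least n - K free vertices.\<close>
lemma card_loose_paths:
  assumes "t \<ge> 2" "u \<in> A" "y \<in> A" "u \<noteq> y" "A \<subseteq> {1..n}" "card A + k * t \<le> K"
  shows "((t - 1) * ((n - K) choose (t - 1))) ^ k * ((n - K) choose (t - 2)) \<le> card (loose_paths (t_subsets n t) k A u y)"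
  using assms(2-)
proof (induction k arbitrary: A u)
  case 0
  have "card (loose_paths (t_subsets n t) 0 A u y) = card {e \<in> t_subsets n t. e \<inter> A = {u, y}}"
    by (auto simp: card_image inj_on_def)
  also have "\<dots> = (n - card A) choose (t - 2)"
    using 0 assms(1) t_subsets_trace[of A n "{u, y}" t] by (simp add: numeral_2_eq_2)
  finally show ?case using 0 by (simp add: binomial_right_mono)
next
  case (Suc k)
  let ?E = "t_subsets n t" and ?T = "{a \<in> steps (t_subsets n t) u. fst a \<inter> A = {u}}"
  let ?L = "((t - 1) * ((n - K) choose (t - 1))) ^ k * ((n - K) choose (t - 2))"
  have finT: "finite ?T"
    by (rule finite_subset[of _ "Pow {1..n} \<times> {1..n}"]) (auto simp: steps_def t_subsets_def)
  have "(t - 1) * ((n - K) choose (t - 1)) \<le> card ?T"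
    using Suc.prems assms(1) by (simp add: card_steps_trace binomial_right_mono)
  then have "(t - 1) * ((n - K) choose (t - 1)) * ?L \<le> (\<Sum>a\<in>?T. ?L)"
    by (simp only: sum_constant of_nat_id) (rule mult_right_mono; simp)
  also have "\<dots> \<le> (\<Sum>a\<in>?T. card (loose_paths ?E k (A \<union> fst a) (snd a) y))"
  proof (rule sum_mono)
    fix a assume a: "a \<in> ?T"
    then have "card (fst a) = t" "fst a \<subseteq> {1..n}" "snd a \<in> fst a" "snd a \<notin> A"
      by (auto simp: steps_def t_subsets_def)
    moreover have "card (A \<union> fst a) \<le> card A + card (fst a)" by (rule card_Un_le)
    ultimately show "?L \<le> card (loose_paths ?E k (A \<union> fst a) (snd a) y)"
      using Suc.prems by (intro Suc.IH) auto
  qed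
  also have "\<dots> = card (loose_paths ?E (Suc k) A u y)"
    using sum_Cons_image[OF finT, of "\<lambda>a. loose_paths ?E k (A \<union> fst a) (snd a) y" "\<lambda>_. 1::nat"]
    by (simp add: finite_loose_paths)
  finally show ?case by (simp add: mult.assoc)
qed

(* Below, walks are handled through the counting lemmas, not by unfolding. *)
declare walks.simps(2) [simp del]

section \<open>Probability that given pairs are far apart\<close>

definition random_edges :: "nat \<Rightarrow> nat \<Rightarrow> (nat set \<Rightarrow> bool) \<Rightarrow> nat hypergraph" where
  "random_edges n t b = ({1..n}, {e \<in> t_subsets n t. b e})"

definition far :: "nat \<Rightarrow> nat \<Rightarrow> nat \<Rightarrow> nat \<times> nat \<Rightarrow> (nat set \<Rightarrow> bool) \<Rightarrow> bool" where
  "far n t d f b \<longleftrightarrow> \<not> hdist (random_edges n t b) (fst f) (snd f) \<le> enat d"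

text \<open>Each unordered pair of distinct vertices is represented once, so that the expected
  number of far pairs is about c / 2.\<close>
definition vertex_pairs :: "nat \<Rightarrow> (nat \<times> nat) set" where
  "vertex_pairs n = {(x, y). 1 \<le> x \<and> x < y \<and> y \<le> n}"

text \<open>The expected number of moves from a fixed vertex along hyperedges that are
  present.\<close>
definition mean_degree :: "nat \<Rightarrow> nat \<Rightarrow> real \<Rightarrow> real" where
  "mean_degree n t p = real (t - 1) * real ((n - 1) choose (t - 1)) * p"

lemma finite_vertex_pairs: "finite (vertex_pairs n)"
  by (rule finite_subset[of _ "{1..n} \<times> {1..n}"]) (auto simp: vertex_pairs_def)

text \<open>The expected number of hyperedges through two fixed vertices is the mean degree
  spread over the other n - 1 vertices.\<close>
lemma codegree_eq:
  assumes "n \<ge> 2" "t \<ge> 2"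
  shows "p * real ((n - 2) choose (t - 2)) = mean_degree n t p / real (n - 1)"
proof -
  obtain t' n' where tn: "t = Suc (Suc t')" "n = Suc (Suc n')"
    using assms by (metis add_2_eq_Suc le_Suc_ex)
  have "real (Suc t' * (Suc n' choose Suc t')) = real (Suc n' * (n' choose t'))"
    by (simp only: binomial_absorption) simp
  then show ?thesis by (simp add: tn mean_degree_def field_simps)
qed

lemma expected_walks_le:
  assumes t: "t \<ge> 2" and n: "n \<ge> 2" and p: "0 \<le> p" and W: "W \<subseteq> walks (t_subsets n t) (Suc k) u y"
  shows "real (card W) * p ^ Suc k \<le> mean_degree n t p ^ Suc k / real (n - 1)"
proof -
  interpret bounded_degree_hypergraph "t_subsets n t" t "(t - 1) * ((n - 1) choose (t - 1))" "(n - 2) choose (t - 2)"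
    by (rule t_subsets_bounded_degree[OF t])
  have "card W \<le> card (walks (t_subsets n t) (Suc k) u y)"
    using W finite_walks by (intro card_mono)
  also have "\<dots> \<le> ((t - 1) * ((n - 1) choose (t - 1))) ^ k * ((n - 2) choose (t - 2))"
    by (rule card_walks)
  finally have "real (card W) * p ^ Suc k \<le>
     real (((t - 1) * ((n - 1) choose (t - 1))) ^ k * ((n - 2) choose (t - 2))) * p ^ Suc k"
    using p by (intro mult_right_mono of_nat_mono) auto
  also have "\<dots> = mean_degree n t p ^ k * (p * real ((n - 2) choose (t - 2)))"
    by (simp add: mean_degree_def power_mult_distrib mult_ac)
  also have "\<dots> = mean_degree n t p ^ Suc k / real (n - 1)"
    by (simp add: codegree_eq[OF n t])
  finally show ?thesis .
qed

text \<open>The pairs in F are far as soon as none of the short walks with distinct hyperedges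
  between them is present. The Harris inequality for the hyperedge sets of these walks
  multiplies the probabilities 1 - x, with x = p ^ length, each of which is at least exp (- (1 +
  2 * p) * x) because x is at most p.\<close>
lemma prob_far_ge:
  assumes t: "t \<ge> 2" and n: "n \<ge> 2" and p: "0 \<le> p" "p \<le> 1/2" and F: "F \<subseteq> vertex_pairs n"
  shows "exp (- (1 + 2 * p) * (real (card F) * (\<Sum>k<d. mean_degree n t p ^ Suc k / real (n - 1))))
     \<le> pr (t_subsets n t) p (\<lambda>b. \<forall>f\<in>F. far n t d f b)"
proof -
  let ?E = "t_subsets n t" and ?l = "mean_degree n t p"
  interpret bounded_degree_hypergraph ?E t "(t - 1) * ((n - 1) choose (t - 1))" "(n - 2) choose (t - 2)"
    by (rule t_subsets_bounded_degree[OF t])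
  have finF: "finite F" using F finite_vertex_pairs finite_subset by blast
  define W where "W f k = {ws \<in> walks ?E (Suc k) (fst f) (snd f). distinct (map fst ws)}" for f :: "nat \<times> nat" and k
  define I where "I = (SIGMA f:F. SIGMA k:{..<d}. W f k)"
  define S :: "(nat \<times> nat) \<times> nat \<times> (nat set \<times> nat) list \<Rightarrow> nat set set"
    where "S = (\<lambda>(f, k, ws). edges_of ws)"
  have finW: "finite (W f k)" for f k unfolding W_def using finite_walks[of "Suc k"] by (simp)
  have finI: "finite I" unfolding I_def using finF finW by (intro finite_SigmaI) auto
  have cardS: "card (S (f, k, ws)) = Suc k" if "ws \<in> W f k" for f k ws
  proof -
    have "length ws = Suc k" using that unfolding W_def by (intro walks_length[of ws ?E _ "fst f" "snd f"]) simp
    moreover have "card (set (map fst ws)) = length (map fst ws)"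
      using that unfolding W_def by (intro distinct_card) simp
    ultimately show ?thesis by (simp add: S_def)
  qed
  have "(\<Sum>i\<in>I. p ^ card (S i)) = (\<Sum>f\<in>F. \<Sum>k<d. \<Sum>ws\<in>W f k. p ^ card (S (f, k, ws)))"
    unfolding I_def using finF finW by (simp add: sum.Sigma)
  also have "\<dots> = (\<Sum>f\<in>F. \<Sum>k<d. real (card (W f k)) * p ^ Suc k)"
    using cardS by simp
  also have "\<dots> \<le> (\<Sum>f\<in>F. \<Sum>k<d. ?l ^ Suc k / real (n - 1))"
    by (intro sum_mono expected_walks_le[OF t n p(1)]) (auto simp: W_def)
  finally have mu: "(\<Sum>i\<in>I. p ^ card (S i)) \<le> real (card F) * (\<Sum>k<d. ?l ^ Suc k / real (n - 1))"
    by simp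
  have factor: "exp (- (1 + 2 * p) * p ^ card (S i)) \<le> 1 - p ^ card (S i)" if iI: "i \<in> I" for i
  proof -
    obtain f k ws where i1: "i = (f, k, ws)" by (cases i) auto
    have i: "i = (f, k, ws)" "ws \<in> W f k" using iI by (simp_all add: i1 I_def)
    define x where "x = p ^ card (S i)"
    have "x = p * p ^ k" using cardS[OF i(2)] i(1) by (simp add: x_def)
    moreover have "p * p ^ k \<le> p * 1" using p by (intro mult_left_mono power_le_one) auto
    ultimately have x: "0 \<le> x" "x \<le> p" using p by auto
    then have "- x - 2 * x\<^sup>2 \<le> ln (1 - x)"
      using p by (intro ln_one_minus_pos_lower_bound) auto
    moreover have "x\<^sup>2 \<le> p * x" using x by (simp add: power2_eq_square mult_right_mono)
    ultimately have "- (1 + 2 * p) * x \<le> ln (1 - x)" by (simp add: algebra_simps)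
    then have "exp (- (1 + 2 * p) * x) \<le> exp (ln (1 - x))" by (simp only: exp_le_cancel_iff)
    also have "\<dots> = 1 - x" using x p by (intro exp_ln) auto
    finally show ?thesis by (simp add: x_def)
  qed
  have "exp (- (1 + 2 * p) * (real (card F) * (\<Sum>k<d. ?l ^ Suc k / real (n - 1))))
     \<le> exp (- (1 + 2 * p) * (\<Sum>i\<in>I. p ^ card (S i)))"
    unfolding exp_le_cancel_iff by (rule mult_left_mono_neg[OF mu]) (use p in simp)
  also have "\<dots> = (\<Prod>i\<in>I. exp (- (1 + 2 * p) * p ^ card (S i)))"
    using finI by (simp only: sum_distrib_left exp_sum)
  also have "\<dots> \<le> (\<Prod>i\<in>I. 1 - p ^ card (S i))"
    using factor by (intro prod_mono) auto
  also have "\<dots> \<le> pr ?E p (\<lambda>b. \<forall>i\<in>I. \<not> (\<forall>e\<in>S i. b e))"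
  proof (rule Harris_no_set_occurs[OF finite_t_subsets])
    show "S i \<subseteq> ?E" if "i \<in> I" for i
      using that walks_edges by (force simp: I_def S_def W_def)
  qed (use p finI in auto)
  also have "\<dots> \<le> pr ?E p (\<lambda>b. \<forall>f\<in>F. far n t d f b)"
  proof (rule pr_mono, rule ballI)
    fix b f assume none: "\<forall>i\<in>I. \<not> (\<forall>e\<in>S i. b e)" and f: "f \<in> F"
    have ne: "fst f \<noteq> snd f" using f F by (auto simp: vertex_pairs_def)
    show "far n t d f b"
      unfolding far_def
    proof
      assume "hdist (random_edges n t b) (fst f) (snd f) \<le> enat d"
      then obtain k ws where *: "k < d" "ws \<in> walks ?E (Suc k) (fst f) (snd f)" "distinct (map fst ws)"
        "edges_of ws \<subseteq> {e \<in> ?E. b e}"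
        unfolding random_edges_def by (rule short_distance_walk[OF _ ne]) auto
      then have "(f, k, ws) \<in> I" using f by (simp add: I_def W_def)
      from bspec[OF none this] show False using *(4) by (auto simp: S_def)
    qed
  qed
  finally show ?thesis .
qed

lemma loose_paths_close:
  assumes "ws \<in> loose_paths (t_subsets n t) k A x y" "x \<in> A" "y \<in> A" "x \<noteq> y" "x \<in> {1..n}" "\<forall>e\<in>edges_of ws. b e"
  shows "\<not> far n t (Suc k) (x, y) b"
proof -
  have w: "ws \<in> walks (t_subsets n t) (Suc k) x y"
    by (rule loose_paths_walks[OF assms(1-4)])
  have "edges_of ws \<subseteq> {e \<in> t_subsets n t. b e}"
    using walks_edges[OF w] assms(6) by blast
  then have "is_hpath ({1..n}, {e \<in> t_subsets n t. b e}) x (x # map snd ws) (map fst ws) y"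
    using loose_paths_distinct[OF assms(1-4)] assms(5)
    by (intro walk_is_hpath[OF w]) (auto simp: t_subsets_def)
  then show ?thesis
    unfolding far_def random_edges_def hdist_le_iff using walks_length[OF w]
    by (auto intro!: exI[of _ "x # map snd ws"] exI[of _ "map fst ws"])
qed

text \<open>The Janson inequality for loose paths of length exactly k + 1 between the pairs in
  F. The vertices of all pairs are forbidden as inner vertices, so a hyperedge set determines
  its pair and path. For a fixed path, the paths overlapping with it without being equal to it
  are mixed with respect to its hyperedges, since all hyperedge sets have the same size; so
  their conditional expectation is bounded by the weight of mixed walks.\<close>
lemma prob_far_le:
  fixes k :: nat
  assumes t: "t \<ge> 2" and n: "n \<ge> 2" and p: "0 \<le> p" "p \<le> 1" and F: "F \<subseteq> vertex_pairs n"
    and l1: "mean_degree n t p \<ge> 1"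
  defines "r \<equiv> real (card F)" and "l \<equiv> mean_degree n t p" and "K \<equiv> 2 * card F + k * t" and "D \<equiv> Suc k * t"
  shows "pr (t_subsets n t) p (\<lambda>b. \<forall>f\<in>F. far n t (Suc k) f b) \<le>
    exp (- (r * ((real (t - 1) * real ((n - K) choose (t - 1)) * p) ^ k * (p * real ((n - K) choose (t - 2)))))
       + r * (l ^ Suc k / real (n - 1)) * (r * (real k * (1 + real D) ^ Suc k * l ^ k / real (n - 1))))"
proof -
  let ?E = "t_subsets n t"
  interpret bounded_degree_hypergraph ?E t "(t - 1) * ((n - 1) choose (t - 1))" "(n - 2) choose (t - 2)"
    by (rule t_subsets_bounded_degree[OF t])
  have finF: "finite F" using F finite_vertex_pairs finite_subset by blast
  define A where "A = fst ` F \<union> snd ` F"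
  have A: "A \<subseteq> {1..n}" using F by (auto simp: A_def vertex_pairs_def)
  have "card A \<le> card (fst ` F) + card (snd ` F)" unfolding A_def by (rule card_Un_le)
  also have "\<dots> \<le> 2 * card F"
    using card_image_le[OF finF, of fst] card_image_le[OF finF, of snd] by simp
  finally have cardA: "card A + k * t \<le> K" by (simp add: K_def)
  define T where "T f = loose_paths ?E k A (fst f) (snd f)" for f
  have fA: "fst f \<in> A" "snd f \<in> A" "fst f \<noteq> snd f" "fst f < snd f" if "f \<in> F" for f
    using that F by (auto simp: A_def vertex_pairs_def)
  have T_walks: "ws \<in> walks ?E (Suc k) (fst f) (snd f)" if "f \<in> F" "ws \<in> T f" for f ws
    using loose_paths_walks that fA unfolding T_def by metis
  have T_dist: "distinct (map fst ws)" if "f \<in> F" "ws \<in> T f" for f ws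
    using loose_paths_distinct that fA unfolding T_def by metis
  define I where "I = (SIGMA f:F. T f)"
  define S where "S i = edges_of (snd i)" for i :: "(nat \<times> nat) \<times> (nat set \<times> nat) list"
  have finT: "finite (T f)" for f unfolding T_def by (rule finite_loose_paths)
  have finI: "finite I" unfolding I_def using finF finT by auto
  have S_E: "S i \<subseteq> ?E" if "i \<in> I" for i
  proof -
    have "fst i \<in> F" "snd i \<in> T (fst i)" using that by (auto simp: I_def)
    from walks_edges[OF T_walks[OF this]] show ?thesis by (simp add: S_def)
  qed
  have cardS: "card (S i) = Suc k" if "i \<in> I" for i
  proof -
    have i: "fst i \<in> F" "snd i \<in> T (fst i)" using that by (auto simp: I_def)
    then show ?thesis
      using walks_length[OF T_walks[OF i]] distinct_card[OF T_dist[OF i]] by (simp add: S_def)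
  qed
  have inj: "i = j" if "i \<in> I" "j \<in> I" "S i = S j" for i j
  proof -
    have i: "fst i \<in> F" "snd i \<in> T (fst i)" and j: "fst j \<in> F" "snd j \<in> T (fst j)"
      using that by (auto simp: I_def)
    have "{fst (fst i), snd (fst i)} = \<Union>(S i) \<inter> A"
      unfolding S_def using loose_paths_meet[OF i(2)[unfolded T_def] fA(1-3)[OF i(1)]] by simp
    also have "\<dots> = {fst (fst j), snd (fst j)}"
      unfolding that(3) unfolding S_def using loose_paths_meet[OF j(2)[unfolded T_def] fA(1-3)[OF j(1)]] by simp
    finally have f: "fst i = fst j"
      using fA(4)[OF i(1)] fA(4)[OF j(1)] by (auto simp: doubleton_eq_iff prod_eq_iff)
    have "snd i = snd j"
      using loose_paths_determined_by_edges[OF i(2)[unfolded T_def] _ fA(1-3)[OF i(1)]] j(2) that(3)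
      by (simp add: f T_def S_def)
    with f show ?thesis by (simp add: prod_eq_iff)
  qed
  have q: "p * real ((n - 2) choose (t - 2)) = l / real (n - 1)"
    unfolding l_def by (rule codegree_eq[OF n t])
  have lD: "p * real ((t - 1) * ((n - 1) choose (t - 1))) \<le> l" by (simp add: l_def mean_degree_def)
  have card_T_le: "real (card (T f)) * p ^ Suc k \<le> l ^ Suc k / real (n - 1)" if "f \<in> F" for f
    unfolding l_def using T_walks[OF that] by (intro expected_walks_le[OF t n p(1)]) auto
  have sum_I: "(\<Sum>i\<in>I. p ^ card (S i)) = (\<Sum>f\<in>F. real (card (T f)) * p ^ Suc k)"
  proof -
    have "(\<Sum>i\<in>I. p ^ card (S i)) = (\<Sum>i\<in>I. p ^ Suc k)" using cardS by simp
    also have "\<dots> = (\<Sum>f\<in>F. real (card (T f)) * p ^ Suc k)"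
      using finF finT by (simp add: I_def sum_distrib_right)
    finally show ?thesis .
  qed
  have mu: "r * ((real (t - 1) * real ((n - K) choose (t - 1)) * p) ^ k * (p * real ((n - K) choose (t - 2))))
      \<le> (\<Sum>i\<in>I. p ^ card (S i))"
  proof -
    have "(real (t - 1) * real ((n - K) choose (t - 1)) * p) ^ k * (p * real ((n - K) choose (t - 2)))
       \<le> real (card (T f)) * p ^ Suc k" if "f \<in> F" for f
    proof -
      have "((t - 1) * ((n - K) choose (t - 1))) ^ k * ((n - K) choose (t - 2)) \<le> card (T f)"
        unfolding T_def by (rule card_loose_paths[OF t fA(1-3)[OF that] A cardA])
      then have "real (((t - 1) * ((n - K) choose (t - 1))) ^ k * ((n - K) choose (t - 2))) * p ^ Suc k
         \<le> real (card (T f)) * p ^ Suc k"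
        using p by (intro mult_right_mono) (auto simp del: of_nat_mult of_nat_power)
      then show ?thesis by (simp add: power_mult_distrib mult_ac)
    qed
    then show ?thesis
      unfolding sum_I r_def by (rule sum_bounded_below)
  qed
  define X where "X = real k * (1 + real D) ^ Suc k * l ^ k / real (n - 1)"
  have X0: "X \<ge> 0" using l1 by (simp add: X_def l_def)
  have overlap: "(\<Sum>j | j \<in> I \<and> j \<noteq> i \<and> S i \<inter> S j \<noteq> {}. p ^ card (S i \<union> S j)) \<le> p ^ card (S i) * (r * X)"
    if i: "i \<in> I" for i
  proof -
    have fS: "finite (S i)" by (simp add: S_def)
    let ?J = "{j \<in> I. mixed (S i) (snd j)}"
    have "(\<Sum>j | j \<in> I \<and> j \<noteq> i \<and> S i \<inter> S j \<noteq> {}. p ^ card (S i \<union> S j))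
        = (\<Sum>j | j \<in> I \<and> j \<noteq> i \<and> S i \<inter> S j \<noteq> {}. p ^ card (S i) * weight (S i) p (snd j))"
    proof (intro sum.cong refl)
      fix j assume "j \<in> {j. j \<in> I \<and> j \<noteq> i \<and> S i \<inter> S j \<noteq> {}}"
      then have j: "fst j \<in> F" "snd j \<in> T (fst j)" by (auto simp: I_def)
      have "card (S i \<union> S j) = card (S i) + card (S j - S i)"
        using fS by (subst card_Un_disjoint[symmetric]) (auto simp: S_def)
      also have "card (S j - S i) = card (set (map fst (filter (\<lambda>a. fst a \<notin> S i) (snd j))))"
        by (intro arg_cong[where f = card]) (auto simp: S_def)
      also have "\<dots> = length (filter (\<lambda>a. fst a \<notin> S i) (snd j))"
        using distinct_card[OF distinct_map_filter[OF T_dist[OF j]]] by simp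
      finally show "p ^ card (S i \<union> S j) = p ^ card (S i) * weight (S i) p (snd j)"
        by (simp add: weight_def power_add)
    qed
    also have "\<dots> \<le> (\<Sum>j\<in>?J. p ^ card (S i) * weight (S i) p (snd j))"
    proof (rule sum_mono2)
      show "{j. j \<in> I \<and> j \<noteq> i \<and> S i \<inter> S j \<noteq> {}} \<subseteq> ?J"
      proof
        fix j assume "j \<in> {j. j \<in> I \<and> j \<noteq> i \<and> S i \<inter> S j \<noteq> {}}"
        then have j: "j \<in> I" "j \<noteq> i" and meet: "S i \<inter> S j \<noteq> {}" by simp_all
        have "\<not> S j \<subseteq> S i"
        proof
          assume "S j \<subseteq> S i"
          then have "S j = S i" using cardS[OF i] cardS[OF j(1)] fS by (intro card_subset_eq) simp_all
          then show False using inj[OF j(1) i] j(2) by simp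
        qed
        then have "mixed (S i) (snd j)"
          using meet unfolding mixed_def S_def[of j] by blast
        then show "j \<in> ?J" using j(1) by simp
      qed
    qed (use finI p in \<open>auto simp: weight_def\<close>)
    also have "\<dots> = p ^ card (S i) * (\<Sum>f\<in>F. \<Sum>ws | ws \<in> T f \<and> mixed (S i) ws. weight (S i) p ws)"
    proof -
      have J: "?J = (SIGMA f:F. {ws \<in> T f. mixed (S i) ws})" by (auto simp: I_def)
      show ?thesis
        unfolding J sum_distrib_left[symmetric]
        using finF finT by (subst sum.Sigma) (auto simp: case_prod_unfold)
    qed
    also have "\<dots> \<le> p ^ card (S i) * (\<Sum>f\<in>F. X)"
    proof (intro mult_left_mono sum_mono)
      fix f assume f: "f \<in> F"
      have "(\<Sum>ws | ws \<in> T f \<and> mixed (S i) ws. weight (S i) p ws)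
         \<le> (\<Sum>ws | ws \<in> walks ?E (Suc k) (fst f) (snd f) \<and> mixed (S i) ws. weight (S i) p ws)"
        using finite_walks T_walks[OF f] p by (intro sum_mono2) (auto simp: weight_def)
      also have "\<dots> \<le> real k * (1 + real D) ^ Suc k * l ^ (k - 1) * (l / real (n - 1))"
      proof (rule sum_mixed_walks[OF S_E[OF i] _ p(1) lD])
        show "card (S i) * t \<le> D" using cardS[OF i] by (simp add: D_def)
        show "1 \<le> l" using l1 by (simp add: l_def)
      qed (simp add: q)
      also have "\<dots> = X"
        by (cases k) (simp_all add: X_def)
      finally show "(\<Sum>ws | ws \<in> T f \<and> mixed (S i) ws. weight (S i) p ws) \<le> X" .
    qed (use p in auto)
    finally show ?thesis by (simp add: r_def)
  qed
  have "(\<Sum>i\<in>I. \<Sum>j | j \<in> I \<and> j \<noteq> i \<and> S i \<inter> S j \<noteq> {}. p ^ card (S i \<union> S j)) \<le> (\<Sum>i\<in>I. p ^ card (S i) * (r * X))"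
    by (intro sum_mono overlap)
  also have "\<dots> = (\<Sum>f\<in>F. real (card (T f)) * p ^ Suc k) * (r * X)"
    by (simp only: sum_distrib_right[symmetric] sum_I)
  also have "\<dots> \<le> (\<Sum>f\<in>F. l ^ Suc k / real (n - 1)) * (r * X)"
    using card_T_le X0 by (intro mult_right_mono sum_mono) (auto simp: r_def)
  also have "\<dots> = r * (l ^ Suc k / real (n - 1)) * (r * X)" by (simp add: r_def)
  finally have Delta: "(\<Sum>i\<in>I. \<Sum>j | j \<in> I \<and> j \<noteq> i \<and> S i \<inter> S j \<noteq> {}. p ^ card (S i \<union> S j))
     \<le> r * (l ^ Suc k / real (n - 1)) * (r * X)" .
  have "pr ?E p (\<lambda>b. \<forall>f\<in>F. far n t (Suc k) f b) \<le> pr ?E p (\<lambda>b. \<forall>i\<in>I. \<not> (\<forall>e\<in>S i. b e))"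
  proof (rule pr_mono, intro ballI notI)
    fix b i assume b: "\<forall>f\<in>F. far n t (Suc k) f b" "i \<in> I" "\<forall>e\<in>S i. b e"
    then have i: "fst i \<in> F" "snd i \<in> T (fst i)" by (auto simp: I_def)
    have "\<not> far n t (Suc k) (fst (fst i), snd (fst i)) b"
      using i fA[OF i(1)] A b(3) by (intro loose_paths_close[of "snd i" n t k A]) (auto simp: T_def S_def)
    then show False using b(1) i(1) by simp
  qed
  also have "\<dots> \<le> exp (- (\<Sum>i\<in>I. p ^ card (S i)) +
      (\<Sum>i\<in>I. \<Sum>j | j \<in> I \<and> j \<noteq> i \<and> S i \<inter> S j \<noteq> {}. p ^ card (S i \<union> S j)))"
    by (rule Janson_inequality[OF finite_t_subsets p finI S_E])
  also have "\<dots> \<le> exp (- (r * ((real (t - 1) * real ((n - K) choose (t - 1)) * p) ^ k * (p * real ((n - K) choose (t - 2)))))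
     + r * (l ^ Suc k / real (n - 1)) * (r * X))"
    unfolding exp_le_cancel_iff using mu Delta by linarith
  finally show ?thesis by (simp only: X_def)
qed

section \<open>Asymptotics at the critical edge probability\<close>

lemma choose_fact_ge:
  assumes "s \<le> m"
  shows "(real m - real s) ^ s \<le> real (m choose s) * fact s"
proof -
  have "(\<Prod>i\<in>{0..<s}. real m - real s) \<le> (\<Prod>i\<in>{0..<s}. real m - real i)"
    using assms by (intro prod_mono) auto
  also have "\<dots> = real (m choose s) * fact s"
    by (simp add: binomial_gbinomial gbinomial_prod_rev)
  finally show ?thesis by simp
qed

lemma choose_fact_le: "real (m choose s) * fact s \<le> real m ^ s"
proof -
  have "real ((m choose s) * fact s) \<le> real (m ^ s)"
    by (rule of_nat_mono[OF binomial_fact_pow])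
  then show ?thesis by simp
qed

text \<open>Both binomial coefficients are compared with powers of n divided by s!. Removing K
  points costs only a factor that tends to 1 at rate 1 / n, fast enough to be harmless when
  multiplied by the logarithm.\<close>
lemma choose_ratio:
  assumes "K + s \<le> n" "n > 0" "m \<le> n" "K + s \<le> B" "B \<le> n"
  shows "(1 - real B / real n) ^ s * real (m choose s) \<le> real ((n - K) choose s)"
proof -
  have "(1 - real B / real n) ^ s * real (m choose s) * fact s \<le> (1 - real B / real n) ^ s * real m ^ s"
    using assms by (simp add: mult.assoc choose_fact_le mult_left_mono)
  also have "\<dots> \<le> (1 - real B / real n) ^ s * real n ^ s"
    using assms by (intro mult_left_mono power_mono) auto
  also have "\<dots> = ((1 - real B / real n) * real n) ^ s"
    by (simp add: power_mult_distrib)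
  also have "(1 - real B / real n) * real n = real n - real B"
    using assms by (simp add: field_simps)
  also have "(real n - real B) ^ s \<le> (real (n - K) - real s) ^ s"
    using assms by (intro power_mono) auto
  also have "\<dots> \<le> real ((n - K) choose s) * fact s"
    using assms by (intro choose_fact_ge) auto
  finally show ?thesis by simp
qed

lemma eventually_ln_ge: "\<forall>\<^sub>F n in sequentially. a \<le> ln (real n)"
  using filterlim_compose[OF ln_at_top filterlim_real_sequentially]
  by (simp add: filterlim_at_top)

lemma ln_square_over:
  assumes "c > 0" "n \<ge> (1::nat)"
  shows "ln ((real n)\<^sup>2 / c) = 2 * ln (real n) - ln c"
  using assms by (simp add: ln_div ln_realpow)

lemma eventually_ln_square_ge:
  assumes "c > 0"
  shows "\<forall>\<^sub>F n in sequentially. a \<le> ln ((real n)\<^sup>2 / c)"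
  using eventually_ln_ge[of "(a + ln c) / 2"] eventually_ge_at_top[of 1]
  by eventually_elim (simp add: ln_square_over[OF assms])

lemma ln_square_power_over_n:
  assumes "c > 0"
  shows "(\<lambda>n. ln ((real n)\<^sup>2 / c) ^ m / real n) \<longlonglongrightarrow> 0"
proof (rule tendsto_sandwich[OF _ _ tendsto_const])
  show "\<forall>\<^sub>F n in sequentially. 0 \<le> ln ((real n)\<^sup>2 / c) ^ m / real n"
    using eventually_ln_square_ge[OF assms, of 0] by eventually_elim simp
  show "\<forall>\<^sub>F n in sequentially. ln ((real n)\<^sup>2 / c) ^ m / real n \<le> 3 ^ m * (ln (real n) ^ m / exp (ln (real n)))"
    using eventually_ln_square_ge[OF assms, of 0] eventually_ln_ge[of "- ln c"] eventually_ge_at_top[of 1]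
  proof eventually_elim
    case (elim n)
    have "ln ((real n)\<^sup>2 / c) \<le> 3 * ln (real n)"
      using elim by (simp add: ln_square_over[OF assms])
    then have "ln ((real n)\<^sup>2 / c) ^ m \<le> (3 * ln (real n)) ^ m"
      using elim by (intro power_mono) auto
    then show ?case
      using elim by (simp add: divide_right_mono power_mult_distrib)
  qed
  have "(\<lambda>n. ln (real n) ^ m / exp (ln (real n))) \<longlonglongrightarrow> 0"
    by (intro filterlim_compose[OF tendsto_power_div_exp_0]
        filterlim_compose[OF ln_at_top filterlim_real_sequentially])
  from tendsto_mult[OF tendsto_const this, of "3 ^ m"]
  show "(\<lambda>n. 3 ^ m * (ln (real n) ^ m / exp (ln (real n)))) \<longlonglongrightarrow> 0" by simp
qed

definition critical :: "real \<Rightarrow> nat \<Rightarrow> nat \<Rightarrow> (nat \<Rightarrow> real) \<Rightarrow> bool" where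
  "critical c t d p \<longleftrightarrow> (\<forall>\<^sub>F n in sequentially. 0 < p n \<and> p n < 1 \<and>
     mean_degree n t (p n) ^ d = real n * ln ((real n)\<^sup>2 / c))"

text \<open>With L the logarithm and l the mean degree, L^2 / l is, up to constants, an upper
  bound for every error term in the two exponents other than those of order L / n.\<close>
definition slack :: "real \<Rightarrow> nat \<Rightarrow> (nat \<Rightarrow> real) \<Rightarrow> nat \<Rightarrow> real" where
  "slack c t p n = ln ((real n)\<^sup>2 / c) ^ 2 / mean_degree n t (p n)"

text \<open>All consequences of the choice of p that the estimates use. The bounds on p come
  from p * ((n - 2) choose (t - 2)) = l / (n - 1) together with l^2 \<le> l^d = n L, which is
  where d \<ge> 2 enters.\<close>
lemma eventually_critical:
  assumes c: "c > 0" and t: "t \<ge> 2" and d: "d \<ge> 2" and crit: "critical c t d p"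
  shows "\<forall>\<^sub>F n in sequentially. 2 \<le> n \<and> 0 < p n \<and> p n < 1 \<and>
     mean_degree n t (p n) ^ d = real n * ln ((real n)\<^sup>2 / c) \<and>
     1 \<le> ln ((real n)\<^sup>2 / c) \<and> 1 \<le> mean_degree n t (p n) \<and>
     ln ((real n)\<^sup>2 / c) / mean_degree n t (p n) \<le> slack c t p n \<and>
     p n \<le> 2 * slack c t p n \<and> p n * ln ((real n)\<^sup>2 / c) \<le> 2 * slack c t p n"
  using crit[unfolded critical_def] eventually_ln_square_ge[OF c, of 1] eventually_ge_at_top[of "max 2 t"]
proof eventually_elim
  case (elim n)
  define L where "L = ln ((real n)\<^sup>2 / c)"
  define l where "l = mean_degree n t (p n)"
  have L: "1 \<le> L" and ld: "l ^ d = real n * L" and p: "0 < p n" "p n < 1" and n: "n \<ge> 2" "n \<ge> t"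
    using elim by (auto simp: L_def l_def)
  have l0: "0 \<le> l" using p by (simp add: l_def mean_degree_def)
  have "1 * 1 \<le> real n * L" using L n by (intro mult_mono) auto
  then have "1 \<le> l ^ d" using ld by simp
  then have l1: "1 \<le> l" using l0 d by (simp add: power_le_one_iff not_less[symmetric] power_less_one_iff)
  have Ll: "L / l \<le> L ^ 2 / l"
    using L l1 by (intro divide_right_mono) (auto simp: power2_eq_square)
  have "l ^ 2 \<le> l ^ d" using l1 d by (intro power_increasing) auto
  then have "l * l \<le> real n * L" using ld by (simp add: power2_eq_square)
  then have ln: "l / real n \<le> L / l" using l1 n by (simp add: field_simps)
  have "1 \<le> (n - 2) choose (t - 2)" using n by (simp add: Suc_leI)
  then have "p n * 1 \<le> p n * real ((n - 2) choose (t - 2))"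
    using p by (intro mult_left_mono) auto
  also have "\<dots> = l / real (n - 1)" unfolding l_def by (rule codegree_eq[OF n(1) t])
  also have "\<dots> \<le> l / (real n / 2)"
    using n l1 by (intro divide_left_mono) auto
  also have "\<dots> = 2 * (l / real n)" by simp
  also have "\<dots> \<le> 2 * (L / l)" using ln by simp
  finally have pL: "p n \<le> 2 * (L / l)" by simp
  have "p n * L \<le> 2 * (L / l) * L" using pL L by (intro mult_right_mono) auto
  also have "\<dots> = 2 * (L ^ 2 / l)" by (simp add: power2_eq_square)
  finally have "p n * L \<le> 2 * (L ^ 2 / l)" .
  then show ?case
    using elim l1 L Ll pL n unfolding slack_def L_def[symmetric] l_def[symmetric] by auto
qed

text \<open>The d-th power of L^2 / l is L^(2 d) / (n L), and powers of a logarithm are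
  negligible against n.\<close>
lemma slack_tendsto_0:
  assumes c: "c > 0" and t: "t \<ge> 2" and d: "d \<ge> 2" and crit: "critical c t d p"
  shows "slack c t p \<longlonglongrightarrow> 0"
proof (rule tendsto_sandwich[OF _ _ tendsto_const])
  show "\<forall>\<^sub>F n in sequentially. 0 \<le> slack c t p n"
    using eventually_critical[OF assms] by eventually_elim auto
  show "\<forall>\<^sub>F n in sequentially. slack c t p n \<le> root d (ln ((real n)\<^sup>2 / c) ^ (2 * d) / real n)"
    using eventually_critical[OF assms]
  proof eventually_elim
    case (elim n)
    define L where "L = ln ((real n)\<^sup>2 / c)"
    have L: "1 \<le> L" and s0: "0 \<le> slack c t p n" using elim by (auto simp: L_def)
    have "slack c t p n ^ d = L ^ (2 * d) / (real n * L)"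
      using elim by (simp add: slack_def L_def power_divide power_mult)
    also have "\<dots> \<le> L ^ (2 * d) / (real n * 1)"
      using L elim by (intro divide_left_mono mult_left_mono) auto
    finally have "root d (slack c t p n ^ d) \<le> root d (L ^ (2 * d) / real n)"
      using d by (intro real_root_le_mono) auto
    then show ?case
      using s0 d by (simp add: L_def real_root_power_cancel)
  qed
  show "(\<lambda>n. root d (ln ((real n)\<^sup>2 / c) ^ (2 * d) / real n)) \<longlonglongrightarrow> 0"
    using tendsto_real_root[OF ln_square_power_over_n[OF c, of "2 * d"], of d] by simp
qed

text \<open>Walks of length d contribute l^d / (n - 1), which is the logarithm up to a factor n
  / (n - 1); shorter ones contribute at most l^(d - 1) / (n - 1), which is of order L / l. The
  second bound is the same estimate for distance d - 1.\<close>
lemma lower_exponent: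
  assumes c: "c > 0" and t: "t \<ge> 2" and d: "d \<ge> 2" and crit: "critical c t d p"
  obtains \<epsilon> where "\<epsilon> \<longlonglongrightarrow> 0" and
    "\<forall>\<^sub>F n in sequentially. (1 + 2 * p n) * (\<Sum>k<d. mean_degree n t (p n) ^ Suc k / real (n - 1))
        \<le> ln ((real n)\<^sup>2 / c) + \<epsilon> n" and
    "\<forall>\<^sub>F n in sequentially. (1 + 2 * p n) * (\<Sum>k<d - 1. mean_degree n t (p n) ^ Suc k / real (n - 1)) \<le> \<epsilon> n"
proof -
  define y where "y = slack c t p"
  define L where "L n = ln ((real n)\<^sup>2 / c)" for n :: nat
  define \<epsilon> where "\<epsilon> n = 4 * y n + (1 + 4 * y n) * (2 * real d * y n + 2 * (L n / real n))" for n
  have y: "y \<longlonglongrightarrow> 0" unfolding y_def by (rule slack_tendsto_0[OF assms])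
  have "(\<lambda>n. L n / real n) \<longlonglongrightarrow> 0"
    unfolding L_def using ln_square_power_over_n[OF c, of 1] by simp
  with y have "\<epsilon> \<longlonglongrightarrow> 4 * 0 + (1 + 4 * 0) * (2 * real d * 0 + 2 * 0)"
    unfolding \<epsilon>_def by (intro tendsto_intros)
  then have eps: "\<epsilon> \<longlonglongrightarrow> 0" by simp
  have ev: "\<forall>\<^sub>F n in sequentially. (1 + 2 * p n) * (\<Sum>k<d. mean_degree n t (p n) ^ Suc k / real (n - 1)) \<le> L n + \<epsilon> n
     \<and> (1 + 2 * p n) * (\<Sum>k<d - 1. mean_degree n t (p n) ^ Suc k / real (n - 1)) \<le> \<epsilon> n"
    using eventually_critical[OF assms]
  proof eventually_elim
    case (elim n)
    define l where "l = mean_degree n t (p n)"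
    have n: "2 \<le> n" and p: "0 < p n" and ld: "l ^ d = real n * L n" and L: "1 \<le> L n" and l: "1 \<le> l"
      and Ll: "L n / l \<le> y n" and py: "p n \<le> 2 * y n" and pL: "p n * L n \<le> 2 * y n"
      using elim by (auto simp: L_def l_def y_def)
    have y0: "0 \<le> y n" using p py by simp
    obtain d' where d': "d = Suc d'" using d by (cases d) auto
    have n1: "real (n - 1) = real n - 1" "real n - 1 > 0" using n by auto
    have nn: "real n / real (n - 1) \<le> 2" using n n1 by (simp add: field_simps)
    have top: "l ^ d / real (n - 1) = L n + L n / real (n - 1)"
      using n1 by (simp add: ld field_simps)
    have Ln: "L n / real (n - 1) \<le> 2 * (L n / real n)"
    proof -
      have "L n / real (n - 1) = (real n / real (n - 1)) * (L n / real n)" using n by simp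
      also have "\<dots> \<le> 2 * (L n / real n)" using nn L by (intro mult_right_mono) auto
      finally show ?thesis .
    qed
    have "l ^ Suc k / real (n - 1) \<le> 2 * y n" if "k < d'" for k
    proof -
      have "l ^ Suc k \<le> l ^ d'" using l that by (intro power_increasing) auto
      also have "\<dots> = real n * L n / l" using ld l by (simp add: d' field_simps)
      finally have "l ^ Suc k / real (n - 1) \<le> (real n * L n / l) / real (n - 1)"
        using n1 by (intro divide_right_mono) auto
      also have "\<dots> = (real n / real (n - 1)) * (L n / l)" by simp
      also have "\<dots> \<le> 2 * y n" using nn Ll L l by (intro mult_mono) auto
      finally show ?thesis .
    qed
    then have "(\<Sum>k<d'. l ^ Suc k / real (n - 1)) \<le> (\<Sum>k<d'. 2 * y n)" by (intro sum_mono) auto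
    also have "\<dots> \<le> 2 * real d * y n" using y0 by (simp add: d' algebra_simps)
    finally have low: "(\<Sum>k<d'. l ^ Suc k / real (n - 1)) \<le> 2 * real d * y n" .
    define w where "w = 2 * real d * y n + 2 * (L n / real n)"
    have w: "0 \<le> w" "2 * real d * y n \<le> w" using y0 L by (auto simp: w_def)
    have e: "\<epsilon> n = 4 * y n + (1 + 4 * y n) * w" by (simp add: \<epsilon>_def w_def)
    have pw: "(1 + 2 * p n) * w \<le> (1 + 4 * y n) * w" using py w by (intro mult_right_mono) auto
    have "(\<Sum>k<d. l ^ Suc k / real (n - 1)) \<le> L n + w"
      using low top Ln by (simp add: d' w_def)
    then have "(1 + 2 * p n) * (\<Sum>k<d. l ^ Suc k / real (n - 1)) \<le> (1 + 2 * p n) * (L n + w)"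
      using p by (intro mult_left_mono) auto
    also have "\<dots> = L n + 2 * (p n * L n) + (1 + 2 * p n) * w" by (simp add: algebra_simps)
    also have "\<dots> \<le> L n + \<epsilon> n" unfolding e using pL pw by linarith
    finally have 1: "(1 + 2 * p n) * (\<Sum>k<d. l ^ Suc k / real (n - 1)) \<le> L n + \<epsilon> n" .
    have "(1 + 2 * p n) * (\<Sum>k<d'. l ^ Suc k / real (n - 1)) \<le> (1 + 2 * p n) * w"
      using low w p by (intro mult_left_mono) auto
    also have "\<dots> \<le> \<epsilon> n" unfolding e using pw y0 by linarith
    finally show ?case using 1 by (simp add: l_def d')
  qed
  show ?thesis
    by (rule that[OF eps]) (use ev in eventually_elim, simp add: L_def)+
qed

text \<open>Restricting to loose paths loses a relative error O(1 / n) in the expected number of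
  paths, hence O(L / n) in the exponent, by Bernoulli's inequality. The overlap term is of order
  l^(2 k + 1) / n^2 for paths of length k + 1, which is of order L^2 / l.\<close>
lemma upper_exponent:
  fixes r :: nat
  assumes c: "c > 0" and t: "t \<ge> 2" and d: "Suc k \<ge> 2" and crit: "critical c t (Suc k) p"
  defines "K \<equiv> 2 * r + k * t" and "D \<equiv> Suc k * t"
  obtains \<epsilon> where "\<epsilon> \<longlonglongrightarrow> 0" and
    "\<forall>\<^sub>F n in sequentially.
     - (real r * ((real (t - 1) * real ((n - K) choose (t - 1)) * p n) ^ k * (p n * real ((n - K) choose (t - 2)))))
       + real r * (mean_degree n t (p n) ^ Suc k / real (n - 1)) *
         (real r * (real k * (1 + real D) ^ Suc k * mean_degree n t (p n) ^ k / real (n - 1)))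
      \<le> - (real r * ln ((real n)\<^sup>2 / c)) + \<epsilon> n"
proof -
  define y where "y = slack c t p"
  define L where "L n = ln ((real n)\<^sup>2 / c)" for n :: nat
  define B where "B = K + t"
  define m where "m = (t - 1) * k + (t - 2)"
  define C where "C = real r * real r * (real k * (1 + real D) ^ Suc k)"
  define \<epsilon> where "\<epsilon> n = real r * (real m * real B) * (L n / real n) + 4 * C * y n" for n
  have y: "y \<longlonglongrightarrow> 0" unfolding y_def by (rule slack_tendsto_0[OF c t d crit])
  have "(\<lambda>n. L n / real n) \<longlonglongrightarrow> 0"
    unfolding L_def using ln_square_power_over_n[OF c, of 1] by simp
  with y have "\<epsilon> \<longlonglongrightarrow> real r * (real m * real B) * 0 + 4 * C * 0"
    unfolding \<epsilon>_def by (intro tendsto_intros)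
  then have eps: "\<epsilon> \<longlonglongrightarrow> 0" by simp
  have C0: "C \<ge> 0" by (simp add: C_def)
  have ev: "\<forall>\<^sub>F n in sequentially.
     - (real r * ((real (t - 1) * real ((n - K) choose (t - 1)) * p n) ^ k * (p n * real ((n - K) choose (t - 2)))))
       + real r * (mean_degree n t (p n) ^ Suc k / real (n - 1)) *
         (real r * (real k * (1 + real D) ^ Suc k * mean_degree n t (p n) ^ k / real (n - 1)))
      \<le> - (real r * L n) + \<epsilon> n"
    using eventually_critical[OF c t d crit] eventually_ge_at_top[of "B + m * B + 1"]
  proof eventually_elim
    case (elim n)
    define l where "l = mean_degree n t (p n)"
    have n: "2 \<le> n" and p: "0 < p n" and ld: "l ^ Suc k = real n * L n" and L: "1 \<le> L n" and l: "1 \<le> l"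
      and Ll: "L n / l \<le> y n"
      using elim by (auto simp: L_def l_def y_def)
    have nB: "B \<le> n" "m * B \<le> n" "n > 0" using elim by auto
    define x where "x = 1 - real B / real n"
    have x: "0 \<le> x" "x \<le> 1" using nB by (auto simp: x_def)
    have c1: "x ^ (t - 1) * real ((n - 1) choose (t - 1)) \<le> real ((n - K) choose (t - 1))"
      unfolding x_def using nB by (intro choose_ratio) (auto simp: B_def)
    have c2: "x ^ (t - 2) * real ((n - 2) choose (t - 2)) \<le> real ((n - K) choose (t - 2))"
      unfolding x_def using nB by (intro choose_ratio) (auto simp: B_def)
    have n1: "real (n - 1) = real n - 1" "real n - 1 > 0" using n by auto
    have nn: "real n / real (n - 1) \<le> 2" "1 \<le> real n / real (n - 1)" using n n1 by (auto simp: field_simps)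
    have q: "p n * real ((n - 2) choose (t - 2)) = l / real (n - 1)"
      unfolding l_def by (rule codegree_eq[OF n t])
    have "x ^ (t - 1) * l = real (t - 1) * (x ^ (t - 1) * real ((n - 1) choose (t - 1))) * p n"
      by (simp add: l_def mean_degree_def)
    also have "\<dots> \<le> real (t - 1) * real ((n - K) choose (t - 1)) * p n"
      using c1 p by (intro mult_right_mono mult_left_mono) auto
    finally have a1: "(x ^ (t - 1) * l) ^ k \<le> (real (t - 1) * real ((n - K) choose (t - 1)) * p n) ^ k"
      using x l by (intro power_mono) auto
    have "x ^ (t - 2) * (l / real (n - 1)) = p n * (x ^ (t - 2) * real ((n - 2) choose (t - 2)))"
      by (simp only: q[symmetric] mult_ac)
    also have "\<dots> \<le> p n * real ((n - K) choose (t - 2))"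
      using c2 p by (intro mult_left_mono) auto
    finally have a2: "x ^ (t - 2) * (l / real (n - 1)) \<le> p n * real ((n - K) choose (t - 2))" .
    have "L n * (1 - real m * (real B / real n)) \<le> L n * x ^ m"
    proof (rule mult_left_mono)
      have "1 + real m * (- (real B / real n)) \<le> (1 + (- (real B / real n))) ^ m"
        using nB by (intro Bernoulli_inequality) auto
      then show "1 - real m * (real B / real n) \<le> x ^ m" by (simp add: x_def)
    qed (use L in auto)
    also have "\<dots> \<le> (real n / real (n - 1)) * (L n * x ^ m)"
      using mult_right_mono[OF nn(2), of "L n * x ^ m"] L x by simp
    also have "\<dots> = (x ^ (t - 1) * l) ^ k * (x ^ (t - 2) * (l / real (n - 1)))"
    proof -
      have "(x ^ (t - 1) * l) ^ k * (x ^ (t - 2) * (l / real (n - 1))) = x ^ m * (l ^ Suc k / real (n - 1))"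
        by (simp add: m_def power_add power_mult power_mult_distrib)
      then show ?thesis by (simp only: ld) (simp add: mult_ac)
    qed
    also have "\<dots> \<le> (real (t - 1) * real ((n - K) choose (t - 1)) * p n) ^ k * (p n * real ((n - K) choose (t - 2)))"
      by (rule mult_mono[OF a1 a2]) (use x l p in auto)
    finally have "real r * (L n * (1 - real m * (real B / real n))) \<le> real r *
        ((real (t - 1) * real ((n - K) choose (t - 1)) * p n) ^ k * (p n * real ((n - K) choose (t - 2))))"
      by (intro mult_left_mono) auto
    moreover have "real r * (L n * (1 - real m * (real B / real n)))
        = real r * L n - real r * (real m * real B) * (L n / real n)"
      by (simp add: algebra_simps)
    moreover have "real r * (l ^ Suc k / real (n - 1)) * (real r * (real k * (1 + real D) ^ Suc k * l ^ k / real (n - 1)))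
       \<le> 4 * C * y n"
    proof -
      have "l ^ k = real n * L n / l" using ld l by (simp add: field_simps)
      then have "real r * (l ^ Suc k / real (n - 1)) * (real r * (real k * (1 + real D) ^ Suc k * l ^ k / real (n - 1)))
         = C * ((real n / real (n - 1)) * (real n / real (n - 1)) * (L n ^ 2 / l))"
        unfolding ld C_def by (simp add: power2_eq_square mult_ac)
      also have "\<dots> \<le> C * (2 * 2 * (L n ^ 2 / l))"
        using nn l C0 by (intro mult_left_mono mult_right_mono mult_mono) auto
      also have "L n ^ 2 / l = y n" by (simp add: y_def slack_def L_def l_def)
      finally show ?thesis by (simp add: mult_ac)
    qed
    ultimately show ?case
      unfolding \<epsilon>_def l_def by linarith
  qed
  show ?thesis
    by (rule that[OF eps]) (use ev in \<open>simp add: L_def\<close>)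
qed

section \<open>The number of far pairs\<close>

text \<open>The passage from Bonferroni bounds of every fixed order to the limit.\<close>
lemma tendsto_from_alternating_bounds:
  fixes P :: "nat \<Rightarrow> real"
  assumes "\<And>r. even r \<Longrightarrow> \<forall>\<^sub>F n in sequentially. P n \<le> s r n"
    and "\<And>r. odd r \<Longrightarrow> \<forall>\<^sub>F n in sequentially. s r n \<le> P n"
    and "\<And>r. s r \<longlonglongrightarrow> a r" "a \<longlonglongrightarrow> l"
  shows "P \<longlonglongrightarrow> l"
proof (rule order_tendstoI)
  fix x assume "x < l"
  with assms(4) have "\<forall>\<^sub>F r in sequentially. x < a r" by (rule order_tendstoD)
  then obtain r0 where "\<And>r. r \<ge> r0 \<Longrightarrow> x < a r" by (auto simp: eventually_sequentially)
  then have "x < a (2 * r0 + 1)" by simp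
  with assms(3) have "\<forall>\<^sub>F n in sequentially. x < s (2 * r0 + 1) n" by (rule order_tendstoD)
  then show "\<forall>\<^sub>F n in sequentially. x < P n"
    using assms(2)[of "2 * r0 + 1", simplified] by eventually_elim simp
next
  fix x assume "x > l"
  with assms(4) have "\<forall>\<^sub>F r in sequentially. a r < x" by (rule order_tendstoD)
  then obtain r0 where "\<And>r. r \<ge> r0 \<Longrightarrow> a r < x" by (auto simp: eventually_sequentially)
  then have "a (2 * r0) < x" by simp
  with assms(3) have "\<forall>\<^sub>F n in sequentially. s (2 * r0) n < x" by (rule order_tendstoD)
  then show "\<forall>\<^sub>F n in sequentially. P n < x"
    using assms(1)[of "2 * r0", simplified] by eventually_elim simp
qed

lemma card_vertex_pairs: "real (card (vertex_pairs n)) = real n * (real n - 1) / 2"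
proof (induction n)
  case 0
  have "vertex_pairs 0 = {}" by (auto simp: vertex_pairs_def)
  then show ?case by simp
next
  case (Suc n)
  have "vertex_pairs (Suc n) = vertex_pairs n \<union> (\<lambda>x. (x, Suc n)) ` {1..n}"
    by (auto simp: vertex_pairs_def)
  moreover have "vertex_pairs n \<inter> (\<lambda>x. (x, Suc n)) ` {1..n} = {}"
    by (auto simp: vertex_pairs_def)
  moreover have "card ((\<lambda>x. (x, Suc n)) ` {1..n}) = n" by (simp add: card_image inj_on_def)
  ultimately have "card (vertex_pairs (Suc n)) = card (vertex_pairs n) + n"
    using finite_vertex_pairs by (simp add: card_Un_disjoint)
  then show ?case using Suc by (simp add: field_simps)
qed

text \<open>The number of pairs times c / n^2 tends to c / 2, and choosing r of many things is
  asymptotically a power divided by r!.\<close>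
lemma pairs_choose_limit:
  assumes "c > 0"
  shows "(\<lambda>n. real (card (vertex_pairs n) choose r) * (c / (real n)\<^sup>2) ^ r) \<longlonglongrightarrow> (c / 2) ^ r / fact r"
proof -
  define m where "m n = real (card (vertex_pairs n))" for n
  have inv: "(\<lambda>n. inverse (real n)) \<longlonglongrightarrow> 0"
    by (rule tendsto_inverse_0_at_top[OF filterlim_real_sequentially])
  have lim: "(\<lambda>n. (((1 - inverse (real n)) / 2 - x * (inverse (real n) * inverse (real n))) * c) ^ r / fact r)
      \<longlonglongrightarrow> (((1 - 0) / 2 - x * (0 * 0)) * c) ^ r / fact r" for x
    by (intro tendsto_intros inv) auto
  have eq: "((m n - x) * (c / (real n)\<^sup>2)) ^ r / fact r
      = (((1 - inverse (real n)) / 2 - x * (inverse (real n) * inverse (real n))) * c) ^ r / fact r" if "n \<ge> 1" for n x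
  proof -
    have "(m n - x) * (c / (real n)\<^sup>2) = ((1 - inverse (real n)) / 2 - x * (inverse (real n) * inverse (real n))) * c"
      using that by (simp add: m_def card_vertex_pairs field_simps power2_eq_square)
    then show ?thesis by simp
  qed
  have lim': "(\<lambda>n. ((m n - x) * (c / (real n)\<^sup>2)) ^ r / fact r) \<longlonglongrightarrow> (c / 2) ^ r / fact r" for x
  proof (rule Lim_transform_eventually)
    show "\<forall>\<^sub>F n in sequentially. (((1 - inverse (real n)) / 2 - x * (inverse (real n) * inverse (real n))) * c) ^ r / fact r
       = ((m n - x) * (c / (real n)\<^sup>2)) ^ r / fact r"
      using eventually_ge_at_top[of 1] by eventually_elim (simp only: eq)
  qed (use lim[of x] in simp)
  have "\<forall>\<^sub>F n in sequentially. r + 1 \<le> n" by (rule eventually_ge_at_top)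
  then have big: "\<forall>\<^sub>F n in sequentially. r \<le> card (vertex_pairs n)"
  proof eventually_elim
    case (elim n)
    have "(\<lambda>x. (x, n)) ` {1..n - 1} \<subseteq> vertex_pairs n" by (auto simp: vertex_pairs_def)
    then have "card ((\<lambda>x. (x, n)) ` {1..n - 1}) \<le> card (vertex_pairs n)"
      by (intro card_mono finite_vertex_pairs)
    then show ?case using elim by (simp add: card_image inj_on_def)
  qed
  show ?thesis
  proof (rule tendsto_sandwich[OF _ _ lim'[of "real r"] lim'[of 0]])
    show "\<forall>\<^sub>F n in sequentially. ((m n - real r) * (c / (real n)\<^sup>2)) ^ r / fact r
        \<le> real (card (vertex_pairs n) choose r) * (c / (real n)\<^sup>2) ^ r"
      using big
    proof eventually_elim
      case (elim n)
      have "(m n - real r) ^ r * (c / (real n)\<^sup>2) ^ r \<le> real (card (vertex_pairs n) choose r) * fact r * (c / (real n)\<^sup>2) ^ r"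
        unfolding m_def using choose_fact_ge[OF elim] assms by (intro mult_right_mono) auto
      then show ?case by (simp only: power_mult_distrib pos_divide_le_eq fact_gt_zero) (simp only: mult_ac)
    qed
    show "\<forall>\<^sub>F n in sequentially. real (card (vertex_pairs n) choose r) * (c / (real n)\<^sup>2) ^ r
        \<le> ((m n - 0) * (c / (real n)\<^sup>2)) ^ r / fact r"
    proof (rule always_eventually, rule allI)
      fix n
      have "real (card (vertex_pairs n) choose r) * fact r * (c / (real n)\<^sup>2) ^ r \<le> m n ^ r * (c / (real n)\<^sup>2) ^ r"
        unfolding m_def using choose_fact_le assms by (intro mult_right_mono) auto
      then show "real (card (vertex_pairs n) choose r) * (c / (real n)\<^sup>2) ^ r \<le> ((m n - 0) * (c / (real n)\<^sup>2)) ^ r / fact r"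
        by (simp only: power_mult_distrib pos_le_divide_eq fact_gt_zero diff_zero) (simp only: mult_ac)
    qed
  qed
qed

text \<open>Any r distinct pairs, disjoint or not, are jointly far with probability (c / n^2)^r
  up to a factor tending to 1, uniformly in the pairs. So the sum is governed by the number of
  r-element sets of pairs alone.\<close>
lemma binomial_moment_limit:
  assumes c: "c > 0" and t: "t \<ge> 2" and d: "d \<ge> 2" and crit: "critical c t d p"
  shows "(\<lambda>n. \<Sum>F | F \<subseteq> vertex_pairs n \<and> card F = r. pr (t_subsets n t) (p n) (\<lambda>b. \<forall>f\<in>F. far n t d f b))
     \<longlonglongrightarrow> (c / 2) ^ r / fact r"
proof -
  obtain k where k: "d = Suc k" using d by (cases d) auto
  define L where "L n = ln ((real n)\<^sup>2 / c)" for n :: nat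
  define m where "m n = real (card (vertex_pairs n) choose r)" for n
  define q where "q n F = pr (t_subsets n t) (p n) (\<lambda>b. \<forall>f\<in>F. far n t d f b)" for n F
  obtain e1 where e1: "e1 \<longlonglongrightarrow> 0" and low: "\<forall>\<^sub>F n in sequentially. (1 + 2 * p n) *
     (\<Sum>k<d. mean_degree n t (p n) ^ Suc k / real (n - 1)) \<le> L n + e1 n"
    unfolding L_def by (rule lower_exponent[OF assms])
  \<comment> \<open>at most 2 r endpoints, plus the vertices of the k earlier hyperedges of a path\<close>
  define K where "K = 2 * r + k * t"
  define D where "D = Suc k * t"
  obtain e2 where e2: "e2 \<longlonglongrightarrow> 0" and upp: "\<forall>\<^sub>F n in sequentially.
     - (real r * ((real (t - 1) * real ((n - K) choose (t - 1)) * p n) ^ k * (p n * real ((n - K) choose (t - 2)))))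
       + real r * (mean_degree n t (p n) ^ Suc k / real (n - 1)) *
         (real r * (real k * (1 + real D) ^ Suc k * mean_degree n t (p n) ^ k / real (n - 1)))
      \<le> - (real r * L n) + e2 n"
    unfolding L_def K_def D_def by (rule upper_exponent[OF c t d[unfolded k] crit[unfolded k]])
  have expL: "exp (- (real r * L n)) = (c / (real n)\<^sup>2) ^ r" if "n \<ge> 2" for n
  proof -
    have "exp (- (real r * L n)) = exp (- L n) ^ r"
      by (simp add: exp_of_nat_mult[symmetric])
    also have "exp (- L n) = c / (real n)\<^sup>2"
      using that c by (simp add: L_def exp_minus inverse_eq_divide)
    finally show ?thesis .
  qed
  have p0: "\<forall>\<^sub>F n in sequentially. p n \<le> 1/2"
  proof -
    have "\<forall>\<^sub>F n in sequentially. slack c t p n < 1/4"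
      by (rule order_tendstoD(2)[OF slack_tendsto_0[OF assms]]) simp
    then show ?thesis using eventually_critical[OF assms] by eventually_elim auto
  qed
  have count: "card {F. F \<subseteq> vertex_pairs n \<and> card F = r} = card (vertex_pairs n) choose r" for n
    by (rule n_subsets[OF finite_vertex_pairs])
  have ml: "(\<lambda>n. m n * (c / (real n)\<^sup>2) ^ r) \<longlonglongrightarrow> (c / 2) ^ r / fact r"
    unfolding m_def by (rule pairs_choose_limit[OF c])
  have "(\<lambda>n. \<Sum>F | F \<subseteq> vertex_pairs n \<and> card F = r. q n F) \<longlonglongrightarrow> (c / 2) ^ r / fact r"
  proof (rule tendsto_sandwich)
    show "\<forall>\<^sub>F n in sequentially. m n * (c / (real n)\<^sup>2) ^ r * exp (- (real r * e1 n)) \<le> (\<Sum>F | F \<subseteq> vertex_pairs n \<and> card F = r. q n F)"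
      using low p0 eventually_critical[OF assms]
    proof eventually_elim
      case (elim n)
      have n: "2 \<le> n" and p: "0 < p n" "p n \<le> 1/2" using elim by auto
      have "exp (- (real r * (L n + e1 n))) \<le> q n F" if F: "F \<subseteq> vertex_pairs n" "card F = r" for F
      proof -
        have "real r * ((1 + 2 * p n) * (\<Sum>k<d. mean_degree n t (p n) ^ Suc k / real (n - 1)))
            \<le> real r * (L n + e1 n)"
          using elim by (intro mult_left_mono) auto
        then have "exp (- (real r * (L n + e1 n))) \<le> exp (- (1 + 2 * p n) *
           (real (card F) * (\<Sum>k<d. mean_degree n t (p n) ^ Suc k / real (n - 1))))"
          unfolding exp_le_cancel_iff F(2) by (simp only: mult_minus_left mult_ac neg_le_iff_le)
        also have "\<dots> \<le> q n F"
          unfolding q_def using p by (intro prob_far_ge[OF t n _ _ F(1)]) auto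
        finally show ?thesis .
      qed
      then have "of_nat (card {F. F \<subseteq> vertex_pairs n \<and> card F = r}) * exp (- (real r * (L n + e1 n)))
         \<le> (\<Sum>F | F \<subseteq> vertex_pairs n \<and> card F = r. q n F)"
        by (intro sum_bounded_below) auto
      moreover have "exp (- (real r * (L n + e1 n))) = (c / (real n)\<^sup>2) ^ r * exp (- (real r * e1 n))"
        by (simp add: expL[OF n, symmetric] exp_add[symmetric] algebra_simps)
      ultimately show ?case by (simp add: count m_def mult.assoc)
    qed
    show "\<forall>\<^sub>F n in sequentially. (\<Sum>F | F \<subseteq> vertex_pairs n \<and> card F = r. q n F) \<le> m n * (c / (real n)\<^sup>2) ^ r * exp (e2 n)"
      using upp eventually_critical[OF assms]
    proof eventually_elim
      case (elim n)
      have n: "2 \<le> n" and p: "0 < p n" "p n < 1" and l: "1 \<le> mean_degree n t (p n)" using elim by auto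
      have "q n F \<le> exp (- (real r * L n) + e2 n)" if F: "F \<subseteq> vertex_pairs n" "card F = r" for F
      proof -
        have "q n F \<le> exp (- (real r * ((real (t - 1) * real ((n - K) choose (t - 1)) * p n) ^ k * (p n * real ((n - K) choose (t - 2)))))
          + real r * (mean_degree n t (p n) ^ Suc k / real (n - 1)) *
         (real r * (real k * (1 + real D) ^ Suc k * mean_degree n t (p n) ^ k / real (n - 1))))"
          unfolding q_def k K_def D_def
          using prob_far_le[OF t n less_imp_le[OF p(1)] less_imp_le[OF p(2)] F(1) l, of k] F(2) by simp
        also have "\<dots> \<le> exp (- (real r * L n) + e2 n)"
          unfolding exp_le_cancel_iff using elim by blast
        finally show ?thesis .
      qed
      then have "(\<Sum>F | F \<subseteq> vertex_pairs n \<and> card F = r. q n F)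
         \<le> of_nat (card {F. F \<subseteq> vertex_pairs n \<and> card F = r}) * exp (- (real r * L n) + e2 n)"
        by (intro sum_bounded_above) auto
      then show ?case by (simp only: count m_def exp_add expL[OF n] mult.assoc)
    qed
    have "(\<lambda>n. m n * (c / (real n)\<^sup>2) ^ r * exp (- (real r * e1 n))) \<longlonglongrightarrow> (c / 2) ^ r / fact r * exp (- (real r * 0))"
      by (intro tendsto_intros ml e1)
    then show "(\<lambda>n. m n * (c / (real n)\<^sup>2) ^ r * exp (- (real r * e1 n))) \<longlonglongrightarrow> (c / 2) ^ r / fact r" by simp
    have "(\<lambda>n. m n * (c / (real n)\<^sup>2) ^ r * exp (e2 n)) \<longlonglongrightarrow> (c / 2) ^ r / fact r * exp 0"
      by (intro tendsto_intros ml e2)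
    then show "(\<lambda>n. m n * (c / (real n)\<^sup>2) ^ r * exp (e2 n)) \<longlonglongrightarrow> (c / 2) ^ r / fact r" by simp
  qed
  then show ?thesis by (simp only: q_def)
qed

section \<open>The diameter\<close>

definition small_diam :: "nat \<Rightarrow> nat \<Rightarrow> nat \<Rightarrow> (nat set \<Rightarrow> bool) \<Rightarrow> bool" where
  "small_diam n t d b \<longleftrightarrow> hdiam (random_edges n t b) \<le> enat d"

lemma hdist_self:
  assumes "x \<in> hverts H"
  shows "hdist H x x = 0"
proof -
  have "is_hpath H x [x] [] x" using assms by (simp add: is_hpath_def)
  then have "hdist H x x \<le> enat 0" unfolding hdist_le_iff by force
  then show ?thesis by (simp add: zero_enat_def[symmetric])
qed

lemma small_diam_iff: "small_diam n t d b \<longleftrightarrow> (\<forall>f\<in>vertex_pairs n. \<not> far n t d f b)"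
proof -
  let ?H = "random_edges n t b"
  have "hdist ?H x y \<le> enat d"
    if all: "\<forall>f\<in>vertex_pairs n. \<not> far n t d f b" and xy: "x \<in> {1..n}" "y \<in> {1..n}" for x y
  proof -
    have 1: "hdist ?H x y \<le> enat d" if "x < y" "x \<in> {1..n}" "y \<in> {1..n}" for x y
      using all that by (force simp: vertex_pairs_def far_def)
    consider "x = y" | "x < y" | "y < x" by linarith
    then show ?thesis
    proof cases
      case 1
      then show ?thesis using xy hdist_self[of x ?H] by (simp add: random_edges_def zero_enat_def[symmetric])
    next
      case 2
      then show ?thesis using 1 xy by blast
    next
      case 3
      then show ?thesis using 1[of y x] xy by (simp add: hdist_sym)
    qed
  qed
  moreover have "hverts ?H = {1..n}" by (simp add: random_edges_def)
  ultimately show ?thesis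
    unfolding small_diam_def hdiam_def SUP_le_iff
    by (auto simp: vertex_pairs_def far_def)
qed

lemma increasing_small_diam: "increasing (small_diam n t d)"
  unfolding increasing_def
proof (intro allI impI)
  fix b b' :: "nat set \<Rightarrow> bool"
  assume le: "\<forall>x. b x \<longrightarrow> b' x" and "small_diam n t d b"
  have "is_hpath (random_edges n t b') x vs es y" if "is_hpath (random_edges n t b) x vs es y" for x y vs es
    using that le by (auto simp: is_hpath_def random_edges_def)
  then have "far n t d f b" if "far n t d f b'" for f
    using that unfolding far_def hdist_le_iff by blast
  with \<open>small_diam n t d b\<close> show "small_diam n t d b'"
    unfolding small_diam_iff by blast
qed

text \<open>The binomial moments of the number of far pairs converge to those of a Poisson
  variable with mean c / 2, and the Bonferroni inequalities turn this into convergence of the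
  probability that there is no far pair.\<close>
theorem prob_small_diam_limit:
  assumes c: "c > 0" and t: "t \<ge> 2" and d: "d \<ge> 2" and crit: "critical c t d p"
  shows "(\<lambda>n. pr (t_subsets n t) (p n) (small_diam n t d)) \<longlonglongrightarrow> exp (- c / 2)"
proof (rule tendsto_from_alternating_bounds)
  let ?S = "\<lambda>j n. \<Sum>F | F \<subseteq> vertex_pairs n \<and> card F = j. pr (t_subsets n t) (p n) (\<lambda>b. \<forall>f\<in>F. far n t d f b)"
  let ?s = "\<lambda>r n. \<Sum>j\<le>r. (-1) ^ j * ?S j n"
  have none: "small_diam n t d = (\<lambda>b. \<forall>f\<in>vertex_pairs n. \<not> far n t d f b)" for n
    by (rule ext) (rule small_diam_iff)
  show "\<forall>\<^sub>F n in sequentially. pr (t_subsets n t) (p n) (small_diam n t d) \<le> ?s r n" if "even r" for r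
  proof (intro always_eventually allI)
    fix n
    show "pr (t_subsets n t) (p n) (small_diam n t d) \<le> ?s r n"
      unfolding none by (rule Bonferroni_inequalities(1)[OF finite_vertex_pairs that])
  qed
  show "\<forall>\<^sub>F n in sequentially. ?s r n \<le> pr (t_subsets n t) (p n) (small_diam n t d)" if "odd r" for r
  proof (intro always_eventually allI)
    fix n
    show "?s r n \<le> pr (t_subsets n t) (p n) (small_diam n t d)"
      unfolding none by (rule Bonferroni_inequalities(2)[OF finite_vertex_pairs that])
  qed
  show "?s r \<longlonglongrightarrow> (\<Sum>j\<le>r. (-1) ^ j * ((c / 2) ^ j / fact j))" for r
    by (intro tendsto_sum tendsto_mult tendsto_const binomial_moment_limit[OF assms])
  have "(\<lambda>j. (-1) ^ j * ((c / 2) ^ j / fact j)) = (\<lambda>j. (- c / 2) ^ j /\<^sub>R fact j)"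
  proof
    fix j
    have "(- c / 2) ^ j = ((-1) * (c / 2)) ^ j" by simp
    also have "\<dots> = (-1) ^ j * (c / 2) ^ j" by (rule power_mult_distrib)
    finally show "(-1) ^ j * ((c / 2) ^ j / fact j) = (- c / 2) ^ j /\<^sub>R fact j"
      by (simp only: divide_inverse real_scaleR_def mult_ac)
  qed
  with exp_converges[of "- c / 2"] have "(\<lambda>j. (-1) ^ j * ((c / 2) ^ j / fact j)) sums exp (- c / 2)"
    by (simp only:)
  then show "(\<lambda>r. \<Sum>j\<le>r. (-1) ^ j * ((c / 2) ^ j / fact j)) \<longlonglongrightarrow> exp (- c / 2)"
    unfolding sums_def_le .
qed

text \<open>The fixed pair (1, 2) is already at distance at least d with probability tending to
  1.\<close>
lemma prob_smaller_diam_limit: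
  assumes c: "c > 0" and t: "t \<ge> 2" and d: "d \<ge> 2" and crit: "critical c t d p"
  shows "(\<lambda>n. pr (t_subsets n t) (p n) (small_diam n t (d - 1))) \<longlonglongrightarrow> 0"
proof -
  obtain e where e: "e \<longlonglongrightarrow> 0" and low: "\<forall>\<^sub>F n in sequentially. (1 + 2 * p n) *
     (\<Sum>k<d - 1. mean_degree n t (p n) ^ Suc k / real (n - 1)) \<le> e n"
    by (rule lower_exponent[OF assms])
  have small: "\<forall>\<^sub>F n in sequentially. slack c t p n < 1/4"
    by (rule order_tendstoD(2)[OF slack_tendsto_0[OF assms]]) simp
  have upper: "\<forall>\<^sub>F n in sequentially. pr (t_subsets n t) (p n) (small_diam n t (d - 1)) \<le> 1 - exp (- e n)"
    using low small eventually_critical[OF assms]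
  proof eventually_elim
    case (elim n)
    let ?P = "pr (t_subsets n t) (p n)"
    have n: "2 \<le> n" and p: "0 \<le> p n" "p n \<le> 1/2" using elim by auto
    have F: "{(1, 2)} \<subseteq> vertex_pairs n" using n by (auto simp: vertex_pairs_def)
    have one: "real (card {(1::nat, 2::nat)}) = 1" by simp
    have "exp (- e n) \<le> exp (- (1 + 2 * p n) * (real (card {(1::nat, 2::nat)}) *
        (\<Sum>k<d - 1. mean_degree n t (p n) ^ Suc k / real (n - 1))))"
      unfolding exp_le_cancel_iff one mult_1 mult_minus_left neg_le_iff_le using elim by blast
    also have "\<dots> \<le> ?P (\<lambda>b. \<forall>f\<in>{(1, 2)}. far n t (d - 1) f b)"
      by (rule prob_far_ge[OF t n p F])
    also have "\<dots> \<le> ?P (\<lambda>b. \<not> small_diam n t (d - 1) b)"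
      by (rule pr_mono) (use F in \<open>auto simp: small_diam_iff\<close>)
    also have "\<dots> = 1 - ?P (small_diam n t (d - 1))" by (rule pr_not)
    finally show ?case by simp
  qed
  have "(\<lambda>n. 1 - exp (- e n)) \<longlonglongrightarrow> 1 - exp (- 0)" by (intro tendsto_intros e)
  then show ?thesis
    by (intro tendsto_sandwich[OF _ upper tendsto_const]) auto
qed

text \<open>The critical edge probability p' for d + 1 and a constant c' is far below p: the
  mean degree raised to the power d + 1 is of order n ln n for p' and larger by a factor of
  order l for p. At p' the diameter is at most d + 1 with limiting probability exp (- c' / 2).
  By monotonicity this is a lower bound for p, and c' is arbitrarily small.\<close>
lemma prob_larger_diam_limit:
  assumes c: "c > 0" and t: "t \<ge> 2" and d: "d \<ge> 2" and crit: "critical c t d p"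
  shows "(\<lambda>n. pr (t_subsets n t) (p n) (small_diam n t (d + 1))) \<longlonglongrightarrow> 1"
proof (rule order_tendstoI)
  fix x :: real assume x: "x < 1"
  \<comment> \<open>small enough for exp (- c' / 2) \<ge> 1 - c' / 2 to exceed x\<close>
  define c' where "c' = 1 - x"
  have c': "c' > 0" using x by (simp add: c'_def)
  define p' where "p' n = root (d + 1) (real n * ln ((real n)\<^sup>2 / c')) / (real (t - 1) * real ((n - 1) choose (t - 1)))" for n
  have small: "\<forall>\<^sub>F n in sequentially. slack c t p n < 1/2"
    by (rule order_tendstoD(2)[OF slack_tendsto_0[OF assms]]) simp
  have ev: "\<forall>\<^sub>F n in sequentially. 0 < p' n \<and> p' n \<le> p n \<and> p n < 1 \<and>
      mean_degree n t (p' n) ^ (d + 1) = real n * ln ((real n)\<^sup>2 / c')"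
    using eventually_critical[OF assms] small eventually_ln_square_ge[OF c', of 1]
      eventually_ln_ge[of "(2 * ln c - ln c') / 2"] eventually_ge_at_top[of t]
  proof eventually_elim
    case (elim n)
    define L where "L = ln ((real n)\<^sup>2 / c)"
    define L' where "L' = ln ((real n)\<^sup>2 / c')"
    define N where "N = real (t - 1) * real ((n - 1) choose (t - 1))"
    define l where "l = mean_degree n t (p n)"
    define l' where "l' = root (d + 1) (real n * L')"
    have n: "2 \<le> n" "t \<le> n" and L: "1 \<le> L" "1 \<le> L'" and ld: "l ^ d = real n * L" and l1: "1 \<le> l"
      and p: "0 < p n" "p n < 1"
      using elim by (auto simp: L_def L'_def l_def)
    have "L / l \<le> slack c t p n" using elim unfolding L_def l_def by blast
    then have s: "L / l < 1/2" using elim by linarith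
    have N: "N > 0" using n t by (simp add: N_def)
    have l'0: "l' > 0" unfolding l'_def using n L by (intro real_root_gt_zero) auto
    have l'd: "l' ^ (d + 1) = real n * L'"
      unfolding l'_def using n L by (intro real_root_pow_pos2) auto
    have "2 * L < l" using s l1 by (simp add: field_simps)
    then have l2: "2 \<le> l" using L by linarith
    have "L' \<le> 2 * L"
      using elim by (simp add: L_def L'_def ln_square_over[OF c] ln_square_over[OF c'])
    also have "\<dots> \<le> l * L" using l2 L by (intro mult_right_mono) auto
    finally have "real n * L' \<le> real n * (l * L)" by (intro mult_left_mono) auto
    then have "l' ^ (d + 1) \<le> l ^ (d + 1)" using l'd ld by (simp add: mult_ac)
    then have ll: "l' \<le> l" using l'0 l1 by (intro power_le_imp_le_base[of l' d l]) auto
    have p': "p' n = l' / N" by (simp add: p'_def l'_def L'_def N_def)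
    have lp: "l = N * p n" by (simp add: l_def mean_degree_def N_def)
    have "p' n \<le> l / N" unfolding p' using ll N by (intro divide_right_mono) auto
    then have "p' n \<le> p n" using N by (simp add: lp)
    moreover have "mean_degree n t (p' n) = N * p' n" by (simp add: mean_degree_def N_def)
    then have "mean_degree n t (p' n) = l'" using N by (simp add: p')
    ultimately show ?case using l'0 l'd N p by (simp add: p' L'_def)
  qed
  have "critical c' t (d + 1) p'"
    unfolding critical_def using ev by eventually_elim auto
  then have "(\<lambda>n. pr (t_subsets n t) (p' n) (small_diam n t (d + 1))) \<longlonglongrightarrow> exp (- c' / 2)"
    using d by (intro prob_small_diam_limit[OF c' t]) auto
  moreover have "x < exp (- c' / 2)"
  proof -
    have "x < 1 + (- c' / 2)" using x by (simp add: c'_def field_simps)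
    also have "\<dots> \<le> exp (- c' / 2)" by (rule exp_ge_add_one_self)
    finally show ?thesis .
  qed
  ultimately have "\<forall>\<^sub>F n in sequentially. x < pr (t_subsets n t) (p' n) (small_diam n t (d + 1))"
    by (rule order_tendstoD)
  then show "\<forall>\<^sub>F n in sequentially. x < pr (t_subsets n t) (p n) (small_diam n t (d + 1))"
    using ev
  proof eventually_elim
    case (elim n)
    have "pr (t_subsets n t) (p' n) (small_diam n t (d + 1)) \<le> pr (t_subsets n t) (p n) (small_diam n t (d + 1))"
      using elim by (intro pr_mono_in_bias finite_t_subsets increasing_small_diam) auto
    then show ?case using elim by linarith
  qed
next
  fix x :: real assume "1 < x"
  then show "\<forall>\<^sub>F n in sequentially. pr (t_subsets n t) (p n) (small_diam n t (d + 1)) < x"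
    by (intro always_eventually allI) (rule le_less_trans[OF measure_pmf.prob_le_1])
qed

lemma random_hypergraph_diam:
  "measure_pmf.prob (random_hypergraph n t p) {H. hdiam H = enat (Suc d)}
     = pr (t_subsets n t) p (small_diam n t (Suc d)) - pr (t_subsets n t) p (small_diam n t d)"
proof -
  have rh: "random_hypergraph n t p = map_pmf (random_edges n t) (coins (t_subsets n t) p)"
    unfolding random_hypergraph_def coins_def random_edges_def[abs_def] ..
  have "(x :: enat) = enat (Suc d) \<longleftrightarrow> x \<le> enat (Suc d) \<and> \<not> x \<le> enat d" for x
    by (cases x) auto
  then have "measure_pmf.prob (random_hypergraph n t p) {H. hdiam H = enat (Suc d)}
     = pr (t_subsets n t) p (\<lambda>b. \<not> small_diam n t d b \<and> small_diam n t (Suc d) b)"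
    unfolding rh by (simp add: vimage_def small_diam_def conj_commute)
  moreover have "small_diam n t d b \<and> small_diam n t (Suc d) b \<longleftrightarrow> small_diam n t d b" for b
    unfolding small_diam_def using order_trans[of _ "enat d" "enat (Suc d)"] by auto
  ultimately show ?thesis
    using pr_split[of "t_subsets n t" p "small_diam n t (Suc d)" "small_diam n t d"] by simp
qed

theorem theorem2:
  fixes c :: real and t d :: nat and p :: "nat \<Rightarrow> real"
  assumes "c > 0" and "t \<ge> 2" and "d \<ge> 2"
    and "\<forall>\<^sub>F n in sequentially. 0 < p n \<and> p n < 1 \<and>
           (real (t - 1) ^ d * real ((n - 1) choose (t - 1)) ^ d * p n ^ d) / real n
             = ln ((real n)\<^sup>2 / c)"
  shows "((\<lambda>n. measure_pmf.prob (random_hypergraph n t (p n)) {H. hdiam H = enat d})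
            \<longlonglongrightarrow> exp (- c / 2)) \<and>
         ((\<lambda>n. measure_pmf.prob (random_hypergraph n t (p n)) {H. hdiam H = enat (d + 1)})
            \<longlonglongrightarrow> 1 - exp (- c / 2))"
proof -
  have crit: "critical c t d p"
    unfolding critical_def using assms(4) eventually_gt_at_top[of 0]
    by eventually_elim (simp add: mean_degree_def power_mult_distrib field_simps)
  note lims = prob_smaller_diam_limit[OF assms(1-3) crit] prob_small_diam_limit[OF assms(1-3) crit]
    prob_larger_diam_limit[OF assms(1-3) crit]
  have d: "Suc (d - 1) = d" using assms(3) by simp
  have "measure_pmf.prob (random_hypergraph n t (p n)) {H. hdiam H = enat d} =
      pr (t_subsets n t) (p n) (small_diam n t d) - pr (t_subsets n t) (p n) (small_diam n t (d - 1))" for n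
    using random_hypergraph_diam[of n t "p n" "d - 1"] unfolding d .
  moreover have "measure_pmf.prob (random_hypergraph n t (p n)) {H. hdiam H = enat (d + 1)} =
      pr (t_subsets n t) (p n) (small_diam n t (d + 1)) - pr (t_subsets n t) (p n) (small_diam n t d)" for n
    using random_hypergraph_diam[of n t "p n" d] unfolding Suc_eq_plus1 .
  ultimately show ?thesis
    using tendsto_diff[OF lims(2,1)] tendsto_diff[OF lims(3,2)] by (simp only: diff_zero simp_thms)
qed

end
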